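(* Let $n\ge1$. As $\Sigma_n$-modules, the sign isotypic subspace $(\mathbb{C}\mathcal{F}_n)^{1^n}$ of the face algebra is isomorphic to $M_\lambda$, where $\lambda=(2^{n/2})$ if $n$ is even and $\lambda=(2^{(n-1)/2},1)$ if $n$ is odd.
   Context: **Face algebra.** $\mathcal{F}_n$ is the monoid of ordered set partitions of $[n]=\{1,\dots,n\}$ (faces of the braid arrangement) with product $(P_1,\dots,P_k)\cdot(Q_1,\dots,Q_\ell)=(P_1\cap Q_1,P_1\cap Q_2,\dots,P_1\cap Q_\ell,P_2\cap Q_1,\dots,P_k\cap Q_\ell)$ with empty sets removed; $\mathbb{C}\mathcal{F}_n$ is its monoid algebra. $S_n$ acts by $\pi(P_1,\dots,P_k)=(\pi(P_1),\dots,\pi(P_k))$, extended linearly; $(\mathbb{C}\mathcal{F}_n)^{S_n}$ is the invariant subalgebra, and $(\mathbb{C}\mathcal{F}_n)^{1^n}$ is the isotypic subspace for the sign character. $\Pi_n$ is the lattice of set partitions of $[n]$ ordered by refinement ($X\le Y$ iff $X$ refines $Y$), with its natural $S_n$-action; $\sigma:\mathcal{F}_n\to\Pi_n$ forgets the order of the blocks. For $\lambda\vdash n$, $X\in\lambda$ means that the block sizes of $X$ are the parts of $\lambda$. **Idempotents.** A cfpoi of an algebra is a complete family of primitive orthogonal idempotents (nonzero idempotents summing to $1$, with pairwise products $0$, none a sum of two nonzero orthogonal idempotents). Fix (following Saliola) a cfpoi $\{\widehat E_X:X\in\Pi_n\}$ of $\mathbb{C}\mathcal{F}_n$ with $\pi(\widehat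 E_X)=\widehat E_{\pi(X)}$ for $\pi\in S_n$ such that: $f\widehat E_X=0$ for $f\in\mathcal{F}_n$ with $\sigma(f)\not\ge X$; $\widehat E_X\in\mathrm{span}_{\mathbb{C}}\{f:\sigma(f)\le X\}$; and the coefficients in $\widehat E_X$ of the faces $f$ with $\sigma(f)=X$ sum to $1$ (such families exist). $\{E_\lambda:\lambda\vdash n\}$ is an arbitrary fixed cfpoi of $(\mathbb{C}\mathcal{F}_n)^{S_n}$, indexed so that for some invertible $u\in(\mathbb{C}\mathcal{F}_n)^{S_n}$ one has $E_\lambda=u\big(\sum_{X\in\lambda}\widehat E_X\big)u^{-1}$ for all $\lambda$ (every cfpoi of $(\mathbb{C}\mathcal{F}_n)^{S_n}$ has this form). **Descent algebra.** $\Sigma_n\subseteq\mathbb{C}S_n$ is the subalgebra spanned by $x_J=\sum_{\pi:\mathrm{Des}(\pi)\subseteq J}\pi$, $J\subseteq[n-1]$, where $\mathrm{Des}(\pi)=\{i:\pi(i)>\pi(i+1)\}$. Bidigare's algebra antiisomorphism $\Phi:\Sigma_n\to(\mathbb{C}\mathcal{F}_n)^{S_n}$ sends $x_J$, $J=\{a_1<\dots<a_k\}$, to the sum of all faces whose successive block sizes are $(a_1,a_2-a_1,\dots,a_k-a_{k-1},n-a_k)$. $\mathbb{C}\mathcal{F}_n$ and its $S_n$-isotypic subspaces are right $\Sigma_n$-modules via $f\cdot x=\Phi(x)f$. $M_\lambda$ is the simple right $\Sigma_n$-module $P_\lambda/\mathrm{rad}(P_\lambda)$, where $P_\lambda=\Phi^{-1}(E_\lambda)\Sigma_n$;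 the $M_\lambda$ ($\lambda\vdash n$) are the simple $\Sigma_n$-modules up to isomorphism. *)

theory Defs
  imports
    Complex_Main
    "HOL-Library.Poly_Mapping"
    "HOL-Library.Disjoint_Sets"
    "HOL-Library.Multiset"
    "HOL-Combinatorics.Permutations"
    "HOL-Algebra.AbelCoset"
    "HOL-Algebra.Sym_Groups"
begin

hide_const (open) Multiset.mult

section \<open>Complex monoid algebras\<close>

text \<open>
  Elements of a complex monoid algebra are finitely supported functions with support in the
  carrier of the monoid. Addition is that of the type \<open>\<Rightarrow>\<^sub>0\<close>; the multiplication of that
  type is not used, since it belongs to an additive index monoid given by a type class.
\<close>

definition scale :: "complex \<Rightarrow> ('a \<Rightarrow>\<^sub>0 complex) \<Rightarrow> ('a \<Rightarrow>\<^sub>0 complex)" where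
  "scale c a = Poly_Mapping.map ((*) c) a"

lemma lookup_scale [simp]: "Poly_Mapping.lookup (scale c a) x = c * Poly_Mapping.lookup a x"
  by (simp add: scale_def Poly_Mapping.map.rep_eq when_def)

interpretation fin_supp: vector_space "scale :: complex \<Rightarrow> ('a \<Rightarrow>\<^sub>0 complex) \<Rightarrow> _"
  by unfold_locales (auto intro!: poly_mapping_eqI simp: lookup_add algebra_simps)

abbreviation basis_elt :: "'a \<Rightarrow> ('a \<Rightarrow>\<^sub>0 complex)" where
  "basis_elt x \<equiv> Poly_Mapping.single x 1"

definition monoid_algebra :: "('a, 'm) monoid_scheme \<Rightarrow> ('a \<Rightarrow>\<^sub>0 complex) ring" where
  "monoid_algebra G =
    \<lparr> carrier = {a. Poly_Mapping.keys a \<subseteq> carrier G},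
      mult = (\<lambda>a b. \<Sum>x\<in>Poly_Mapping.keys a. \<Sum>y\<in>Poly_Mapping.keys b.
                Poly_Mapping.single (x \<otimes>\<^bsub>G\<^esub> y)
                  (Poly_Mapping.lookup a x * Poly_Mapping.lookup b y)),
      one = basis_elt \<one>\<^bsub>G\<^esub>,
      zero = 0,
      add = (+) \<rparr>"


section \<open>Complete families of primitive orthogonal idempotents\<close>

definition primitive_idempotent :: "('a, 'm) ring_scheme \<Rightarrow> 'a \<Rightarrow> bool" where
  "primitive_idempotent A e \<longleftrightarrow>
     e \<in> carrier A \<and> e \<noteq> \<zero>\<^bsub>A\<^esub> \<and> e \<otimes>\<^bsub>A\<^esub> e = e \<and>
     \<not> (\<exists>a\<in>carrier A. \<exists>b\<in>carrier A.
          a \<noteq> \<zero>\<^bsub>A\<^esub> \<and> b \<noteq> \<zero>\<^bsub>A\<^esub> \<and>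
          a \<otimes>\<^bsub>A\<^esub> a = a \<and> b \<otimes>\<^bsub>A\<^esub> b = b \<and>
          a \<otimes>\<^bsub>A\<^esub> b = \<zero>\<^bsub>A\<^esub> \<and> b \<otimes>\<^bsub>A\<^esub> a = \<zero>\<^bsub>A\<^esub> \<and>
          e = a \<oplus>\<^bsub>A\<^esub> b)"

definition cfpoi :: "('a, 'm) ring_scheme \<Rightarrow> 'i set \<Rightarrow> ('i \<Rightarrow> 'a) \<Rightarrow> bool" where
  "cfpoi A I e \<longleftrightarrow>
     finite I \<and>
     (\<forall>i\<in>I. primitive_idempotent A (e i)) \<and>
     (\<forall>i\<in>I. \<forall>j\<in>I. i \<noteq> j \<longrightarrow> e i \<otimes>\<^bsub>A\<^esub> e j = \<zero>\<^bsub>A\<^esub>) \<and>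
     (\<Oplus>\<^bsub>A\<^esub>i\<in>I. e i) = \<one>\<^bsub>A\<^esub>"


section \<open>Right modules\<close>

text \<open>
  The library's modules are over commutative rings. As there, the module is a record extending
  \<^typ>\<open>'m ring\<close> of which only the additive part and the action matter; its \<open>mult\<close> and \<open>one\<close>
  are irrelevant.
\<close>

record ('r, 'm) right_mod = "'m ring" +
  ract :: "'m \<Rightarrow> 'r \<Rightarrow> 'm" (infixl "\<triangleleft>\<index>" 70)

definition regular_right_mod :: "('r, 'x) ring_scheme \<Rightarrow> ('r, 'r) right_mod" where
  "regular_right_mod R =
    \<lparr> carrier = carrier R, mult = mult R, one = one R, zero = zero R, add = add R,
      ract = mult R \<rparr>"

definition right_submodule ::
  "('r, 'x) ring_scheme \<Rightarrow> ('r, 'm, 'y) right_mod_scheme \<Rightarrow> 'm set \<Rightarrow> bool" where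
  "right_submodule R M N \<longleftrightarrow>
     additive_subgroup N M \<and> (\<forall>m\<in>N. \<forall>r\<in>carrier R. m \<triangleleft>\<^bsub>M\<^esub> r \<in> N)"

definition maximal_right_submodule ::
  "('r, 'x) ring_scheme \<Rightarrow> ('r, 'm, 'y) right_mod_scheme \<Rightarrow> 'm set \<Rightarrow> bool" where
  "maximal_right_submodule R M N \<longleftrightarrow>
     right_submodule R M N \<and> N \<noteq> carrier M \<and>
     (\<forall>L. right_submodule R M L \<and> N \<subseteq> L \<longrightarrow> L = N \<or> L = carrier M)"

text \<open>A module without maximal submodules is its own radical.\<close>

definition rad :: "('r, 'x) ring_scheme \<Rightarrow> ('r, 'm, 'y) right_mod_scheme \<Rightarrow> 'm set" where
  "rad R M = carrier M \<inter> \<Inter> {N. maximal_right_submodule R M N}"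

text \<open>
  In the quotient, \<open>(N + m) \<triangleleft> r = N + (m \<triangleleft> r)\<close>; the union below is over all representatives,
  each of which gives the same coset when \<open>N\<close> is a submodule.
\<close>

definition quot_right_mod ::
  "('r, 'm, 'y) right_mod_scheme \<Rightarrow> 'm set \<Rightarrow> ('r, 'm set) right_mod" where
  "quot_right_mod M N =
    \<lparr> carrier = a_rcosets\<^bsub>M\<^esub> N, mult = undefined, one = undefined,
      zero = N, add = set_add M,
      ract = (\<lambda>C r. \<Union>m\<in>C. N +>\<^bsub>M\<^esub> (m \<triangleleft>\<^bsub>M\<^esub> r)) \<rparr>"

definition right_mod_iso ::
  "('r, 'x) ring_scheme \<Rightarrow> ('r, 'm, 'y) right_mod_scheme \<Rightarrow> ('r, 'n, 'z) right_mod_scheme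
     \<Rightarrow> ('m \<Rightarrow> 'n) set" where
  "right_mod_iso R M N =
     {h. bij_betw h (carrier M) (carrier N) \<and>
         (\<forall>a\<in>carrier M. \<forall>b\<in>carrier M. h (a \<oplus>\<^bsub>M\<^esub> b) = h a \<oplus>\<^bsub>N\<^esub> h b) \<and>
         (\<forall>a\<in>carrier M. \<forall>r\<in>carrier R. h (a \<triangleleft>\<^bsub>M\<^esub> r) = h a \<triangleleft>\<^bsub>N\<^esub> r)}"

definition right_mod_isomorphic ::
  "('r, 'x) ring_scheme \<Rightarrow> ('r, 'm, 'y) right_mod_scheme \<Rightarrow> ('r, 'n, 'z) right_mod_scheme
     \<Rightarrow> bool" where
  "right_mod_isomorphic R M N \<longleftrightarrow> right_mod_iso R M N \<noteq> {}"


section \<open>The face algebra\<close>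

definition set_partitions :: "nat \<Rightarrow> nat set set set" where
  "set_partitions n = {X. partition_on {1..n} X}"

definition faces :: "nat \<Rightarrow> nat set list set" where
  "faces n = {f. distinct f \<and> partition_on {1..n} (set f)}"

text \<open>
  The support map \<open>\<sigma>\<close> from faces to set partitions is \<^const>\<open>set\<close>. The unit is correct for \<open>n \<ge> 1\<close>.
\<close>

definition face_mult :: "nat set list \<Rightarrow> nat set list \<Rightarrow> nat set list" where
  "face_mult f g = filter (\<lambda>B. B \<noteq> {}) (concat (map (\<lambda>P. map (\<lambda>Q. P \<inter> Q) g) f))"

definition face_monoid :: "nat \<Rightarrow> nat set list monoid" where
  "face_monoid n = \<lparr> carrier = faces n, mult = face_mult, one = [{1..n}] \<rparr>"

definition face_algebra :: "nat \<Rightarrow> (nat set list \<Rightarrow>\<^sub>0 complex) ring" where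
  "face_algebra n = monoid_algebra (face_monoid n)"

definition perm_act ::
  "(nat \<Rightarrow> nat) \<Rightarrow> (nat set list \<Rightarrow>\<^sub>0 complex) \<Rightarrow> (nat set list \<Rightarrow>\<^sub>0 complex)" where
  "perm_act p a = (\<Sum>f\<in>Poly_Mapping.keys a.
     Poly_Mapping.single (map (image p) f) (Poly_Mapping.lookup a f))"

definition invariant_algebra :: "nat \<Rightarrow> (nat set list \<Rightarrow>\<^sub>0 complex) ring" where
  "invariant_algebra n = (face_algebra n)
     \<lparr> carrier := {a \<in> carrier (face_algebra n). \<forall>p\<in>carrier (sym_group n). perm_act p a = a} \<rparr>"

definition sign_isotypic :: "nat \<Rightarrow> (nat set list \<Rightarrow>\<^sub>0 complex) set" where
  "sign_isotypic n =
     {a \<in> carrier (face_algebra n).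
        \<forall>p\<in>carrier (sym_group n). perm_act p a = scale (of_int (sign p)) a}"

text \<open>
  Saliola's families: the order on set partitions is refinement, so \<open>refines {1..n} X Y\<close>
  is \<open>X \<le> Y\<close>.
\<close>

definition saliola_family ::
  "nat \<Rightarrow> (nat set set \<Rightarrow> (nat set list \<Rightarrow>\<^sub>0 complex)) \<Rightarrow> bool" where
  "saliola_family n F \<longleftrightarrow>
     cfpoi (face_algebra n) (set_partitions n) F \<and>
     (\<forall>p\<in>carrier (sym_group n). \<forall>X\<in>set_partitions n. perm_act p (F X) = F (image p ` X)) \<and>
     (\<forall>X\<in>set_partitions n. \<forall>f\<in>faces n.
        \<not> refines {1..n} X (set f) \<longrightarrow> basis_elt f \<otimes>\<^bsub>face_algebra n\<^esub> F X = 0) \<and>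
     (\<forall>X\<in>set_partitions n.
        F X \<in> fin_supp.span (basis_elt ` {f \<in> faces n. refines {1..n} (set f) X})) \<and>
     (\<forall>X\<in>set_partitions n. (\<Sum>f | f \<in> faces n \<and> set f = X. Poly_Mapping.lookup (F X) f) = 1)"

text \<open>Integer partitions of \<open>n\<close> are multisets of positive parts.\<close>

definition int_partitions :: "nat \<Rightarrow> nat multiset set" where
  "int_partitions n = {l. 0 \<notin># l \<and> \<Sum>\<^sub># l = n}"

definition block_type :: "nat set set \<Rightarrow> nat multiset" where
  "block_type X = image_mset card (mset_set X)"


section \<open>The descent algebra\<close>

definition descents :: "nat \<Rightarrow> (nat \<Rightarrow> nat) \<Rightarrow> nat set" where
  "descents n p = {i \<in> {1..<n}. p i > p (Suc i)}"

definition x_elt :: "nat \<Rightarrow> nat set \<Rightarrow> ((nat \<Rightarrow> nat) \<Rightarrow>\<^sub>0 complex)" where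
  "x_elt n J = (\<Sum>p | p \<in> carrier (sym_group n) \<and> descents n p \<subseteq> J. basis_elt p)"

definition descent_algebra :: "nat \<Rightarrow> ((nat \<Rightarrow> nat) \<Rightarrow>\<^sub>0 complex) ring" where
  "descent_algebra n = (monoid_algebra (sym_group n))
     \<lparr> carrier := fin_supp.span (x_elt n ` Pow {1..<n}) \<rparr>"

text \<open>\<open>{a\<^sub>1 < \<dots> < a\<^sub>k}\<close> is sent to \<open>[a\<^sub>1, a\<^sub>2 - a\<^sub>1, \<dots>, n - a\<^sub>k]\<close>.\<close>

definition composition_of :: "nat \<Rightarrow> nat set \<Rightarrow> nat list" where
  "composition_of n J =
     map2 (-) (sorted_list_of_set J @ [n]) (0 # sorted_list_of_set J)"

definition face_sum :: "nat \<Rightarrow> nat set \<Rightarrow> (nat set list \<Rightarrow>\<^sub>0 complex)" where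
  "face_sum n J = (\<Sum>f | f \<in> faces n \<and> map card f = composition_of n J. basis_elt f)"

text \<open>
  Bidigare's map is the linear extension of \<open>x_elt n J \<mapsto> face_sum n J\<close>; the description is
  unique because the \<open>x_elt n J\<close> form a basis of the descent algebra.
\<close>

definition bidigare ::
  "nat \<Rightarrow> ((nat \<Rightarrow> nat) \<Rightarrow>\<^sub>0 complex) \<Rightarrow> (nat set list \<Rightarrow>\<^sub>0 complex)" where
  "bidigare n x = (THE y. \<exists>c.
      x = (\<Sum>J\<in>Pow {1..<n}. scale (c J) (x_elt n J)) \<and>
      y = (\<Sum>J\<in>Pow {1..<n}. scale (c J) (face_sum n J)))"

definition face_right_mod ::
  "nat \<Rightarrow> ((nat \<Rightarrow> nat) \<Rightarrow>\<^sub>0 complex, nat set list \<Rightarrow>\<^sub>0 complex) right_mod" where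
  "face_right_mod n =
    \<lparr> carrier = carrier (face_algebra n), mult = mult (face_algebra n),
      one = one (face_algebra n), zero = zero (face_algebra n), add = add (face_algebra n),
      ract = (\<lambda>f x. bidigare n x \<otimes>\<^bsub>face_algebra n\<^esub> f) \<rparr>"

definition sign_right_mod ::
  "nat \<Rightarrow> ((nat \<Rightarrow> nat) \<Rightarrow>\<^sub>0 complex, nat set list \<Rightarrow>\<^sub>0 complex) right_mod" where
  "sign_right_mod n = (face_right_mod n) \<lparr> carrier := sign_isotypic n \<rparr>"

text \<open>For an idempotent \<open>e\<close> of the invariant algebra: \<open>\<Phi>\<^sup>-\<^sup>1(e) \<Sigma>\<^sub>n\<close> and its top.\<close>

definition proj_right_mod ::
  "nat \<Rightarrow> (nat set list \<Rightarrow>\<^sub>0 complex)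
     \<Rightarrow> ((nat \<Rightarrow> nat) \<Rightarrow>\<^sub>0 complex, (nat \<Rightarrow> nat) \<Rightarrow>\<^sub>0 complex) right_mod" where
  "proj_right_mod n e = (regular_right_mod (descent_algebra n))
     \<lparr> carrier := {the_inv_into (carrier (descent_algebra n)) (bidigare n) e
                      \<otimes>\<^bsub>descent_algebra n\<^esub> x | x. x \<in> carrier (descent_algebra n)} \<rparr>"

definition simple_right_mod ::
  "nat \<Rightarrow> (nat set list \<Rightarrow>\<^sub>0 complex)
     \<Rightarrow> ((nat \<Rightarrow> nat) \<Rightarrow>\<^sub>0 complex, ((nat \<Rightarrow> nat) \<Rightarrow>\<^sub>0 complex) set) right_mod" where
  "simple_right_mod n e =
     quot_right_mod (proj_right_mod n e) (rad (descent_algebra n) (proj_right_mod n e))"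

end

theory Submission
  imports Defs
begin

text \<open>
  A face with a block of size at least two is fixed by a transposition, so the sign isotypic
  subspace is spanned by the alternating sum \<open>s\<close> of the chambers. Write \<open>f C = \<pi>\<^sub>f C\<close>, where \<open>C\<close> is the
  chamber of the identity. The inverse of Bidigare's map sends an invariant \<open>b = \<Sum> b\<^sub>f f\<close> to
  \<open>\<Sum> b\<^sub>f \<pi>\<^sub>f\<close>, and the descent algebra acts on \<open>s\<close> through the restriction of the sign character
  of the symmetric group, so that \<open>b s = \<chi>(b) s\<close> with \<open>\<chi>(b) = \<Sum> b\<^sub>f sgn(\<pi>\<^sub>f)\<close>.

  Let \<open>X = {{1,2},{3,4},\<dots>}\<close>. Exchanging \<open>i\<close> and \<open>i + 1\<close> for the first pair \<open>{i, i + 1}\<close> of \<open>X\<close>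
  that is separated by \<open>f\<close> changes the sign of \<open>\<pi>\<^sub>f\<close>, and \<open>\<pi>\<^sub>f\<close> is even if no pair is separated;
  hence \<open>\<chi>(b)\<close> is the sum of the \<open>b\<^sub>f\<close> with \<open>\<sigma>(f) \<ge> X\<close>. By the support conditions this
  functional vanishes on \<open>E_hat Y\<close> for \<open>Y \<noteq> X\<close> of the same type and is \<open>1\<close> on \<open>E_hat X\<close>, so
  \<open>\<chi>(E\<^sub>\<lambda>) = 1\<close>.

  Finally, if \<open>e\<close> is a primitive idempotent of a finite-dimensional algebra with a character
  \<open>\<theta>\<close> such that \<open>\<theta>(e) = 1\<close>, then the kernel of \<open>\<theta>\<close> on \<open>e R\<close> is its only maximal submodule.
\<close>

section \<open>Linear extension and complex algebras\<close>

text \<open>\<open>bidigare\<close> is a description over combinations of the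
  \<open>x_elt n J\<close>, whereas sending a face to its permutation is linear on the whole face
  algebra. Computations therefore run through the inverse map, and the descent algebra is treated as
  the image of the invariants. This rests on the bijection between the faces of one type and the
  permutations whose descents lie in the corresponding set.

  The pairs come from the involution that is to cancel signs. Exchanging consecutive values that lie
  in different blocks keeps the order within every block, and disjointness of the pairs ensures that
  an exchange leaves the set of separated pairs unchanged. Pairs starting at odd numbers have both
  properties, whence the parts 2 and a leftover 1 for odd \<open>n\<close>.

  The values of \<open>\<chi>\<close> commute, so conjugation by the unit \<open>u\<close> drops out
  and the arbitrary family \<open>E\<close> is reached from \<open>E_hat\<close>. Only partitions of
  one type enter that computation, so counting blocks is enough to compare them. A one-dimensional
  module is determined by its character, so identifying the top reduces to finding a kernel.\<close>

abbreviation linear_fun ::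
  "(complex \<Rightarrow> 'b \<Rightarrow> 'b::ab_group_add) \<Rightarrow> (('a \<Rightarrow>\<^sub>0 complex) \<Rightarrow> 'b) \<Rightarrow> bool" where
  "linear_fun \<equiv> Vector_Spaces.linear scale"

text \<open>The scalar action \<open>s\<close> is a parameter because the values lie sometimes in a
  space of finitely supported functions and sometimes in \<open>complex\<close>.\<close>

definition linext ::
  "(complex \<Rightarrow> 'b \<Rightarrow> 'b::ab_group_add) \<Rightarrow> ('a \<Rightarrow> 'b) \<Rightarrow> ('a \<Rightarrow>\<^sub>0 complex) \<Rightarrow> 'b" where
  "linext s \<phi> a = (\<Sum>x\<in>Poly_Mapping.keys a. s (Poly_Mapping.lookup a x) (\<phi> x))"

interpretation complex_vs: vector_space "(*) :: complex \<Rightarrow> complex \<Rightarrow> complex"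
  by unfold_locales (auto simp: algebra_simps)

lemma linext_superset:
  assumes "vector_space s" "finite S" "Poly_Mapping.keys a \<subseteq> S"
  shows "linext s \<phi> a = (\<Sum>x\<in>S. s (Poly_Mapping.lookup a x) (\<phi> x))"
proof -
  interpret vector_space s by fact
  show ?thesis
    unfolding linext_def using assms(2,3)
    by (intro sum.mono_neutral_left) (auto simp: in_keys_iff)
qed

lemma linear_linext:
  assumes "vector_space s"
  shows "linear_fun s (linext s \<phi>)"
proof -
  interpret vector_space s by fact
  have "linext s \<phi> (a + b) = linext s \<phi> a + linext s \<phi> b" for a b
  proof -
    \<comment> \<open>A common index set is needed, since cancellation can make the keys of
      \<open>a + b\<close> smaller than this union.\<close>
    let ?S = "Poly_Mapping.keys a \<union> Poly_Mapping.keys b"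
    have "linext s \<phi> c = (\<Sum>x\<in>?S. s (Poly_Mapping.lookup c x) (\<phi> x))"
      if "c \<in> {a, b, a + b}" for c
      using that keys_add[of a b] by (intro linext_superset assms) auto
    then show ?thesis
      by (simp add: lookup_add scale_left_distrib sum.distrib)
  qed
  moreover have "linext s \<phi> (scale c a) = s c (linext s \<phi> a)" for c a
  proof -
    have "linext s \<phi> (scale c a)
        = (\<Sum>x\<in>Poly_Mapping.keys a. s (Poly_Mapping.lookup (scale c a) x) (\<phi> x))"
      by (intro linext_superset assms) (auto simp: in_keys_iff)
    then show ?thesis
      by (simp add: linext_def scale_sum_right)
  qed
  ultimately show ?thesis
    by unfold_locales auto
qed

lemmas linear_linext_scale [simp, intro] = linear_linext[OF fin_supp.vector_space_axioms]
lemmas linear_linext_times [simp, intro] = linear_linext[OF complex_vs.vector_space_axioms]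

lemma linext_basis_elt [simp]:
  "vector_space s \<Longrightarrow> linext s \<phi> (basis_elt x) = \<phi> x"
  by (simp add: linext_def vector_space.vector_space_assms(4))

lemma single_eq_scale: "Poly_Mapping.single x c = scale c (basis_elt x)"
  by (rule poly_mapping_eqI) (simp add: lookup_single when_def)

lemma sum_basis_elt:
  "a = (\<Sum>x\<in>Poly_Mapping.keys a. scale (Poly_Mapping.lookup a x) (basis_elt x))"
proof (rule poly_mapping_eqI)
  fix k
  have "Poly_Mapping.lookup a k
      = (\<Sum>x\<in>Poly_Mapping.keys a. if x = k then Poly_Mapping.lookup a x else 0)"
    by (simp add: in_keys_iff)
  also have "\<dots> = (\<Sum>x\<in>Poly_Mapping.keys a.
      Poly_Mapping.lookup (scale (Poly_Mapping.lookup a x) (basis_elt x)) k)"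
    by (intro sum.cong) (auto simp: lookup_single when_def)
  finally show "Poly_Mapping.lookup a k = Poly_Mapping.lookup (\<Sum>x\<in>Poly_Mapping.keys a.
      scale (Poly_Mapping.lookup a x) (basis_elt x)) k"
    by (simp add: lookup_sum)
qed

text \<open>Testing only the basis elements in the support of \<open>a\<close> makes the carrier
  conditions on \<open>a\<close> available at each of them.\<close>

lemma linear_fun_eqI:
  assumes "linear_fun s f" "linear_fun s g"
    and "\<And>x. x \<in> Poly_Mapping.keys a \<Longrightarrow> f (basis_elt x) = g (basis_elt x)"
  shows "f a = g a"
proof -
  interpret f: Vector_Spaces.linear scale s f by fact
  interpret g: Vector_Spaces.linear scale s g by fact
  let ?b = "\<Sum>x\<in>Poly_Mapping.keys a. scale (Poly_Mapping.lookup a x) (basis_elt x)"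
  have "f ?b = g ?b"
    by (simp add: f.sum g.sum f.scale g.scale assms(3))
  then show ?thesis
    by (simp flip: sum_basis_elt)
qed

lemma linear_linext_fun:
  assumes "vector_space t" "vector_space s" "\<And>x. Vector_Spaces.linear t s (\<phi> x)"
  shows "Vector_Spaces.linear t s (\<lambda>b. linext s (\<lambda>x. \<phi> x b) a)"
proof -
  interpret s: vector_space s by fact
  interpret t: vector_space t by fact
  interpret p: Vector_Spaces.linear t s "\<phi> x" for x by fact
  show ?thesis
    by unfold_locales
      (auto simp: linext_def p.add p.scale sum.distrib s.scale_right_distrib s.scale_sum_right mult.commute)
qed

lemma fin_supp_span_basis_elt:
  fixes S :: "'a set"
  shows "fin_supp.span (basis_elt ` S) = {a. Poly_Mapping.keys a \<subseteq> S}"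
proof
  have "{a. Poly_Mapping.keys a \<subseteq> S}
      = {a :: 'a \<Rightarrow>\<^sub>0 complex. \<forall>x. x \<notin> S \<longrightarrow> Poly_Mapping.lookup a x = 0}"
    by (auto simp: in_keys_iff)
  moreover have "fin_supp.subspace \<dots>"
    by (simp add: fin_supp.subspace_def lookup_add)
  ultimately have "fin_supp.subspace {a. Poly_Mapping.keys a \<subseteq> S}"
    by (rule ssubst)
  then show "fin_supp.span (basis_elt ` S) \<subseteq> {a. Poly_Mapping.keys a \<subseteq> S}"
    by (intro fin_supp.span_minimal) (auto simp: subset_iff)
  show "{a. Poly_Mapping.keys a \<subseteq> S} \<subseteq> fin_supp.span (basis_elt ` S)"
  proof
    fix a :: "'a \<Rightarrow>\<^sub>0 complex"
    assume "a \<in> {a. Poly_Mapping.keys a \<subseteq> S}"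
    then have "(\<Sum>x\<in>Poly_Mapping.keys a. scale (Poly_Mapping.lookup a x) (basis_elt x))
        \<in> fin_supp.span (basis_elt ` S)"
      by (intro fin_supp.span_sum fin_supp.span_scale fin_supp.span_base) auto
    then show "a \<in> fin_supp.span (basis_elt ` S)"
      by (simp flip: sum_basis_elt)
  qed
qed

lemma subspace_keys: "fin_supp.subspace {a. Poly_Mapping.keys a \<subseteq> S}"
  by (simp flip: fin_supp_span_basis_elt)

text \<open>Written as nested linear extensions, the product is visibly bilinear for arbitrary
  arguments, with no carrier hypotheses to discharge.\<close>

lemma mult_monoid_algebra:
  "a \<otimes>\<^bsub>monoid_algebra G\<^esub> b
     = linext scale (\<lambda>x. linext scale (\<lambda>y. basis_elt (x \<otimes>\<^bsub>G\<^esub> y)) b) a"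
  by (simp add: monoid_algebra_def linext_def single_eq_scale[of _ "_ * _"] fin_supp.scale_sum_right
      flip: fin_supp.scale_scale)

lemma linear_mult_left [simp]: "linear_fun scale (\<lambda>a. a \<otimes>\<^bsub>monoid_algebra G\<^esub> b)"
  by (simp add: mult_monoid_algebra)

lemma linear_mult_right [simp]: "linear_fun scale (\<lambda>b. a \<otimes>\<^bsub>monoid_algebra G\<^esub> b)"
  unfolding mult_monoid_algebra
  by (intro linear_linext_fun) (auto simp: fin_supp.vector_space_axioms)

lemma mult_basis_elt [simp]:
  "basis_elt x \<otimes>\<^bsub>monoid_algebra G\<^esub> basis_elt y = basis_elt (x \<otimes>\<^bsub>G\<^esub> y)"
  by (simp add: mult_monoid_algebra fin_supp.vector_space_axioms)

lemma linear_fun_comp: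
  "linear_fun scale f \<Longrightarrow> linear_fun s g \<Longrightarrow> linear_fun s (\<lambda>a. g (f a))"
  using Vector_Spaces.linear_compose[of scale scale f s g] by (simp add: comp_def)

section \<open>Rings carried by subspaces of finitely supported functions\<close>

lemma abelian_group_subspace:
  fixes M :: "('a \<Rightarrow>\<^sub>0 complex, 'm) ring_scheme" (structure)
  assumes "fin_supp.subspace (carrier M)" "\<And>x y. x \<oplus> y = x + y" "\<zero> = 0"
  shows "abelian_group M"
proof (rule abelian_groupI)
  fix x assume "x \<in> carrier M"
  then show "\<exists>y\<in>carrier M. y \<oplus> x = \<zero>"
    by (intro bexI[of _ "- x"]) (simp_all add: assms fin_supp.subspace_neg)
qed (simp_all add: assms fin_supp.subspace_0 fin_supp.subspace_add add_ac)

lemma additive_subgroup_subspace: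
  fixes M :: "('a \<Rightarrow>\<^sub>0 complex, 'm) ring_scheme" (structure)
  assumes "fin_supp.subspace (carrier M)" "\<And>x y. x \<oplus> y = x + y" "\<zero> = 0"
    and "fin_supp.subspace K" "K \<subseteq> carrier M"
  shows "additive_subgroup K M"
proof -
  interpret abelian_group M
    using assms(1-3) by (rule abelian_group_subspace)
  have "\<ominus> x = - x" if "x \<in> K" for x
    using that assms(5) fin_supp.subspace_neg[OF assms(1), of x]
    by (intro minus_equality) (auto simp: assms(2,3))
  then show ?thesis
    using assms(4,5) fin_supp.subspace_0[OF assms(4)]
    by (intro additive_subgroup.intro add.subgroupI)
      (auto simp: assms(2) fin_supp.subspace_neg fin_supp.subspace_add simp flip: a_inv_def)
qed

text \<open>Tying sum and zero of the ring to those of the type makes spans, independence and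
  subspaces applicable to the carrier.\<close>

locale complex_algebra = ring R for R :: "('a \<Rightarrow>\<^sub>0 complex, 'm) ring_scheme" (structure) +
  assumes add_eq [simp]: "x \<oplus> y = x + y"
    and zero_eq [simp]: "\<zero> = 0"
    and subspace_carrier: "fin_supp.subspace (carrier R)"
    and scale_mult [simp]: "x \<in> carrier R \<Longrightarrow> y \<in> carrier R \<Longrightarrow> scale c x \<otimes> y = scale c (x \<otimes> y)"
    and mult_scale [simp]: "x \<in> carrier R \<Longrightarrow> y \<in> carrier R \<Longrightarrow> x \<otimes> scale c y = scale c (x \<otimes> y)"

lemma complex_algebraI:
  fixes R :: "('a \<Rightarrow>\<^sub>0 complex, 'm) ring_scheme" (structure)
  assumes "\<And>x y. x \<oplus> y = x + y" "\<zero> = 0" "monoid R" "fin_supp.subspace (carrier R)"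
    and "\<And>x. linear_fun scale (\<lambda>y. x \<otimes> y)" "\<And>x. linear_fun scale (\<lambda>y. y \<otimes> x)"
  shows "complex_algebra R"
proof -
  interpret monoid R by fact
  interpret r: Vector_Spaces.linear scale scale "\<lambda>y. x \<otimes> y" for x by fact
  interpret l: Vector_Spaces.linear scale scale "\<lambda>y. y \<otimes> x" for x by fact
  have "abelian_group R"
    using assms(4,1,2) by (rule abelian_group_subspace)
  then interpret ring R
    using assms(3) by (intro ringI) (simp_all add: assms(1) r.add l.add)
  show ?thesis
    using assms(4) by unfold_locales (simp_all add: assms(1,2) r.scale l.scale)
qed

lemma complex_algebra_monoid_algebra:
  assumes "monoid G"
  shows "complex_algebra (monoid_algebra G)"
proof (rule complex_algebraI)
  interpret G: monoid G by fact
  let ?A = "monoid_algebra G"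
  have carr: "carrier ?A = {a. Poly_Mapping.keys a \<subseteq> carrier G}"
    by (simp add: monoid_algebra_def)
  show "fin_supp.subspace (carrier ?A)"
    unfolding carr by (rule subspace_keys)
  note lin = linear_mult_left linear_mult_right
  have closed: "a \<otimes>\<^bsub>?A\<^esub> b \<in> carrier ?A" if "a \<in> carrier ?A" "b \<in> carrier ?A" for a b
  proof -
    have "a \<otimes>\<^bsub>?A\<^esub> b \<in> fin_supp.span (basis_elt ` carrier G)"
      unfolding mult_monoid_algebra linext_def
      using that by (intro fin_supp.span_sum fin_supp.span_scale fin_supp.span_base)
        (auto simp: carr)
    then show ?thesis
      by (simp add: carr fin_supp_span_basis_elt)
  qed
  \<comment> \<open>Both sides are trilinear, so associativity descends to the monoid by reducing
    one argument at a time to basis elements.\<close>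
  have assoc: "a \<otimes>\<^bsub>?A\<^esub> b \<otimes>\<^bsub>?A\<^esub> c = a \<otimes>\<^bsub>?A\<^esub> (b \<otimes>\<^bsub>?A\<^esub> c)"
    if "a \<in> carrier ?A" "b \<in> carrier ?A" "c \<in> carrier ?A" for a b c
  proof (rule linear_fun_eqI[where a = a])
    fix x assume x: "x \<in> Poly_Mapping.keys a"
    show "basis_elt x \<otimes>\<^bsub>?A\<^esub> b \<otimes>\<^bsub>?A\<^esub> c = basis_elt x \<otimes>\<^bsub>?A\<^esub> (b \<otimes>\<^bsub>?A\<^esub> c)"
    proof (rule linear_fun_eqI[where a = b])
      fix y assume y: "y \<in> Poly_Mapping.keys b"
      show "basis_elt x \<otimes>\<^bsub>?A\<^esub> basis_elt y \<otimes>\<^bsub>?A\<^esub> c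
          = basis_elt x \<otimes>\<^bsub>?A\<^esub> (basis_elt y \<otimes>\<^bsub>?A\<^esub> c)"
      proof (rule linear_fun_eqI[where a = c])
        fix z assume z: "z \<in> Poly_Mapping.keys c"
        have "x \<in> carrier G" "y \<in> carrier G" "z \<in> carrier G"
          using x y z that by (auto simp: carr)
        then show "basis_elt x \<otimes>\<^bsub>?A\<^esub> basis_elt y \<otimes>\<^bsub>?A\<^esub> basis_elt z
          = basis_elt x \<otimes>\<^bsub>?A\<^esub> (basis_elt y \<otimes>\<^bsub>?A\<^esub> basis_elt z)"
          by (simp add: G.m_assoc)
      qed (rule lin(2) linear_fun_comp[OF lin(2) lin(2)])+
    qed (rule linear_fun_comp[OF lin(2) lin(1)] linear_fun_comp[OF lin(1) lin(2)])+
  qed (rule linear_fun_comp[OF lin(1) lin(1)] lin(1))+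
  have one: "\<one>\<^bsub>?A\<^esub> = basis_elt \<one>\<^bsub>G\<^esub>"
    by (simp add: monoid_algebra_def)
  have id: "linear_fun scale (\<lambda>a. a)"
    by unfold_locales auto
  show "monoid ?A"
  proof
    show "\<one>\<^bsub>?A\<^esub> \<in> carrier ?A" by (simp add: one carr)
    fix a assume a: "a \<in> carrier ?A"
    show "\<one>\<^bsub>?A\<^esub> \<otimes>\<^bsub>?A\<^esub> a = a"
      by (rule linear_fun_eqI[OF lin(2) id]) (use a in \<open>auto simp: one carr\<close>)
    show "a \<otimes>\<^bsub>?A\<^esub> \<one>\<^bsub>?A\<^esub> = a"
      by (rule linear_fun_eqI[OF lin(1) id]) (use a in \<open>auto simp: one carr\<close>)
  qed (auto intro: closed assoc)
qed (simp_all, simp_all add: monoid_algebra_def)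

lemma (in complex_algebra) complex_subalgebra:
  assumes "fin_supp.subspace S" "S \<subseteq> carrier R" "\<one> \<in> S" "\<And>x y. x \<in> S \<Longrightarrow> y \<in> S \<Longrightarrow> x \<otimes> y \<in> S"
  shows "complex_algebra (R\<lparr>carrier := S\<rparr>)"
proof -
  have "abelian_group (R\<lparr>carrier := S\<rparr>)"
    by (rule abelian_group_subspace) (simp_all add: assms(1))
  moreover have "monoid (R\<lparr>carrier := S\<rparr>)"
    using assms(2-4) by unfold_locales (auto simp: m_assoc subset_iff)
  ultimately interpret S: ring "R\<lparr>carrier := S\<rparr>"
    using assms(2) l_distr r_distr by (intro ringI) (auto simp: subset_iff)
  show ?thesis
    using assms(1,2) by unfold_locales (auto simp: subset_iff)
qed


section \<open>The top of a primitive right ideal\<close>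

text \<open>Otherwise prepending one power after another would produce arbitrarily long independent
  families, against the bound \<open>card T\<close>.\<close>

lemma (in complex_algebra) power_in_span_later_powers:
  assumes "finite T" "carrier R \<subseteq> fin_supp.span T" "z \<in> carrier R"
  obtains k where "z [^] k \<in> fin_supp.span ((\<lambda>i::nat. z [^] i) ` {k<..})"
proof (rule ccontr)
  assume "\<not> thesis"
  with that have later: "z [^] k \<notin> fin_supp.span ((\<lambda>i::nat. z [^] i) ` {k<..})" for k
    by blast
  \<comment> \<open>Independence of a set does not see repetitions, so the cardinality is carried
    through the induction as well.\<close>
  have "fin_supp.independent ((\<lambda>i. z [^] i) ` {k..<k + N}) \<and>
      card ((\<lambda>i. z [^] i) ` {k..<k + N}) = N" for k N :: nat
  proof (induction N arbitrary: k)
    case (Suc N)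
    have *: "{k..<k + Suc N} = insert k {Suc k..<Suc k + N}"
      by auto
    have "z [^] k \<notin> fin_supp.span ((\<lambda>i. z [^] i) ` {Suc k..<Suc k + N})"
      using later[of k] fin_supp.span_mono[of "(\<lambda>i. z [^] i) ` {Suc k..<Suc k + N}"
          "(\<lambda>i. z [^] i) ` {k<..}"] by fastforce
    moreover from this have "z [^] k \<notin> (\<lambda>i. z [^] i) ` {Suc k..<Suc k + N}"
      using fin_supp.span_base by blast
    ultimately show ?case
      unfolding * image_insert using Suc.IH[of "Suc k"]
      by (simp add: fin_supp.independent_insertI del: image_Suc_lessThan)
  qed (simp add: fin_supp.independent_empty)
  from this[of 0 "Suc (card T)"] show False
    using fin_supp.independent_span_bound[OF assms(1), of "(\<lambda>i. z [^] i) ` {0..<Suc (card T)}"]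
      assms(2,3) by (auto simp: image_subset_iff subset_iff)
qed

text \<open>A relation \<open>z [^] k = z [^] Suc k \<otimes> q\<close> with \<open>q\<close>
  commuting with \<open>z\<close> makes \<open>q\<close> an inverse of \<open>z\<close> away from
  its nilpotent part. The idempotent projects to that part; the last conclusion shows that it can
  vanish only if \<open>z\<close> is nilpotent.\<close>

lemma (in complex_algebra) fitting_idempotent:
  assumes "finite T" "carrier R \<subseteq> fin_supp.span T" and z: "z \<in> carrier R"
  obtains g a and k :: nat
  where "a \<in> carrier R" "g = z \<otimes> a" "g = a \<otimes> z" "g \<otimes> g = g" "z [^] k \<otimes> g = z [^] k"
proof -
  obtain k where k: "z [^] k \<in> fin_supp.span ((\<lambda>i::nat. z [^] i) ` {k<..})"
    using power_in_span_later_powers[OF assms] .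
  \<comment> \<open>The condition of commuting with \<open>z\<close> is linear, so \<open>W\<close>
    is a subspace. It contains all powers beyond \<open>k\<close> and hence \<open>z [^] k\<close>,
    which provides a \<open>q\<close> that commutes with \<open>z\<close>.\<close>
  define W where "W = {z [^] Suc k \<otimes> q | q. q \<in> carrier R \<and> q \<otimes> z = z \<otimes> q}"
  have "fin_supp.subspace W"
  proof (rule fin_supp.subspaceI)
    show "0 \<in> W"
      unfolding W_def using z zero_closed r_null[of "z [^] Suc k"] l_null[of z] r_null[of z]
      by (auto intro!: exI[of _ 0] simp del: nat_pow_Suc)
    fix x y assume "x \<in> W" "y \<in> W"
    then obtain p q where "x = z [^] Suc k \<otimes> p" "y = z [^] Suc k \<otimes> q" "p \<in> carrier R"
      "q \<in> carrier R" "p \<otimes> z = z \<otimes> p" "q \<otimes> z = z \<otimes> q"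
      by (auto simp: W_def)
    then show "x + y \<in> W"
      unfolding W_def using z l_distr[of p q z] r_distr[of p q "z [^] Suc k"] r_distr[of p q z]
        a_closed[of p q] by (auto intro!: exI[of _ "p + q"] simp del: nat_pow_Suc)
  next
    fix c x assume "x \<in> W"
    then obtain p where "x = z [^] Suc k \<otimes> p" "p \<in> carrier R" "p \<otimes> z = z \<otimes> p"
      by (auto simp: W_def)
    then show "scale c x \<in> W"
      unfolding W_def using z fin_supp.subspace_scale[OF subspace_carrier, of p c]
      by (auto intro!: exI[of _ "scale c p"] simp del: nat_pow_Suc)
  qed
  moreover have "z [^] i \<in> W" if "k < i" for i
  proof -
    have "z [^] i = z [^] Suc k \<otimes> z [^] (i - Suc k)"
      using that z by (subst nat_pow_mult) auto
    moreover have "z [^] (i - Suc k) \<otimes> z = z \<otimes> z [^] (i - Suc k)"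
      using z nat_pow_Suc2 by auto
    ultimately show ?thesis
      unfolding W_def using z by blast
  qed
  ultimately have "z [^] k \<in> W"
    using k fin_supp.span_minimal[of "(\<lambda>i. z [^] i) ` {k<..}" W] by auto
  then obtain q where q: "q \<in> carrier R" "q \<otimes> z = z \<otimes> q" and zk: "z [^] k = z [^] Suc k \<otimes> q"
    unfolding W_def by blast
  define r where "r = z \<otimes> q"
  have r: "r \<in> carrier R" "r \<otimes> z = z \<otimes> r"
    using z q by (auto simp: r_def m_assoc)
  have zkr: "z [^] k \<otimes> r = z [^] k"
    using zk z q by (simp add: r_def m_assoc)
  then have zmr: "z [^] Suc k \<otimes> r = z [^] Suc k"
    using z r by (simp add: m_assoc) (metis m_assoc nat_pow_closed)
  \<comment> \<open>With exponent \<open>Suc k\<close> the factor \<open>z [^] Suc k\<close> absorbs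
    a further \<open>r\<close>, and one factor \<open>z\<close> can be split off even if
    \<open>k = 0\<close>.\<close>
  define g where "g = r [^] Suc k"
  have g: "g = q [^] Suc k \<otimes> z [^] Suc k"
    unfolding g_def r_def using z q by (metis pow_mult_distrib)
  have gc: "g \<in> carrier R"
    using r by (simp add: g_def)
  have gr: "g \<otimes> r = g"
    unfolding g using z q r zmr by (simp add: m_assoc del: nat_pow_Suc)
  have "g \<otimes> r [^] j = g" for j :: nat
    using r gc gr by (induction j) (simp_all add: m_assoc[symmetric])
  from this[of "Suc k"] have gg: "g \<otimes> g = g"
    by (simp only: g_def)
  have zkg: "z [^] k \<otimes> g = z [^] k"
  proof -
    have "z [^] k \<otimes> r [^] j = z [^] k" for j :: nat
      using z r zkr by (induction j) (simp_all add: m_assoc[symmetric])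
    from this[of "Suc k"] show ?thesis by (simp only: g_def)
  qed
  define a where "a = q \<otimes> r [^] k"
  have a: "a \<in> carrier R" "g = z \<otimes> a"
    using z q r nat_pow_Suc2[of r k] by (auto simp: g_def a_def r_def m_assoc)
  have "r [^] k \<otimes> z = z \<otimes> r [^] k"
    using group_commutes_pow[OF r(2) r(1) z] .
  then have "a \<otimes> z = z \<otimes> a"
    using z q r by (simp add: a_def m_assoc) (metis m_assoc nat_pow_closed)
  with a gg zkg show thesis
    by (intro that[of a g k]) auto
qed

section \<open>Characters and the right ideal of a primitive idempotent\<close>

locale algebra_character = complex_algebra R
  for R :: "('a \<Rightarrow>\<^sub>0 complex, 'm) ring_scheme" (structure) +
  fixes \<theta> :: "('a \<Rightarrow>\<^sub>0 complex) \<Rightarrow> complex"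
  assumes char_add [simp]: "x \<in> carrier R \<Longrightarrow> y \<in> carrier R \<Longrightarrow> \<theta> (x + y) = \<theta> x + \<theta> y"
    and char_scale [simp]: "x \<in> carrier R \<Longrightarrow> \<theta> (scale c x) = c * \<theta> x"
    and char_mult [simp]: "x \<in> carrier R \<Longrightarrow> y \<in> carrier R \<Longrightarrow> \<theta> (x \<otimes> y) = \<theta> x * \<theta> y"
    and char_one [simp]: "\<theta> \<one> = 1"
begin

lemma char_power: "x \<in> carrier R \<Longrightarrow> \<theta> (x [^] (k::nat)) = \<theta> x ^ k"
  by (induction k) auto

lemma char_minus:
  assumes "x \<in> carrier R" "y \<in> carrier R"
  shows "\<theta> (x - y) = \<theta> x - \<theta> y"
proof -
  have "x - y \<in> carrier R"
    using assms subspace_carrier by (rule_tac fin_supp.subspace_diff)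
  from char_add[OF this assms(2)] show ?thesis
    by simp
qed

context
  fixes e T
  assumes e: "primitive_idempotent R e" and char_e: "\<theta> e = 1"
    and T: "finite T" "carrier R \<subseteq> fin_supp.span T"
begin

abbreviation (input) "P \<equiv> {e \<otimes> x | x. x \<in> carrier R}"
abbreviation (input) "MP \<equiv> regular_right_mod R \<lparr> carrier := P \<rparr>"
abbreviation (input) "K \<equiv> {y \<in> P. \<theta> y = 0}"

lemma e_closed: "e \<in> carrier R" and e_idem: "e \<otimes> e = e"
  using e by (auto simp: primitive_idempotent_def)

lemma P_iff: "y \<in> P \<longleftrightarrow> y \<in> carrier R \<and> e \<otimes> y = y"
proof -
  have "e \<otimes> (e \<otimes> x) = e \<otimes> x" if "x \<in> carrier R" for x
    using that e_closed e_idem by (simp flip: m_assoc)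
  then show ?thesis
    using e_closed by force
qed

lemma P_subspace: "fin_supp.subspace P"
proof (rule fin_supp.subspaceI)
  show "0 \<in> P"
    using zero_closed r_null[OF e_closed] by (simp only: P_iff) simp
  show "x + y \<in> P" if "x \<in> P" "y \<in> P" for x y
    using that e_closed r_distr[of x y e] a_closed[of x y] by (simp only: P_iff) simp
  show "scale c x \<in> P" if "x \<in> P" for c x
    using that e_closed fin_supp.subspace_scale[OF subspace_carrier, of x c]
    by (simp only: P_iff) simp
qed

lemma K_subspace: "fin_supp.subspace K"
proof (rule fin_supp.subspaceI)
  have "\<theta> (scale 0 e) = 0"
    using e_closed by (subst char_scale) auto
  then show "0 \<in> K"
    using fin_supp.subspace_0[OF P_subspace] by simp
  show "x + y \<in> K" if "x \<in> K" "y \<in> K" for x y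
    using that fin_supp.subspace_add[OF P_subspace, of x y] 
    by (simp only: mem_Collect_eq P_iff[unfolded mem_Collect_eq]) simp
  show "scale c x \<in> K" if "x \<in> K" for c x
    using that fin_supp.subspace_scale[OF P_subspace, of x c] 
    by (simp only: mem_Collect_eq P_iff[unfolded mem_Collect_eq]) simp
qed

lemma P_act: "y \<in> P \<Longrightarrow> x \<in> carrier R \<Longrightarrow> y \<otimes> x \<in> P"
  using e_closed by (simp only: P_iff) (metis m_assoc m_closed)

text \<open>Submodules are only required to be additive subgroups; closure under scalars comes from
  the action of \<open>scale c \<one>\<close>.\<close>

lemma submoduleD:
  assumes "right_submodule R MP L"
  shows "L \<subseteq> P" and "fin_supp.subspace L" and "\<And>y x. y \<in> L \<Longrightarrow> x \<in> carrier R \<Longrightarrow> y \<otimes> x \<in> L"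
proof -
  have "subgroup L (add_monoid MP)"
    and act: "\<And>y x. y \<in> L \<Longrightarrow> x \<in> carrier R \<Longrightarrow> y \<otimes> x \<in> L"
    using assms by (auto simp: right_submodule_def additive_subgroup_def regular_right_mod_def)
  then have L: "L \<subseteq> P" "\<And>x y. x \<in> L \<Longrightarrow> y \<in> L \<Longrightarrow> x + y \<in> L" "0 \<in> L"
    using subgroup.subset[of L "add_monoid MP"] subgroup.m_closed[of L "add_monoid MP"]
      subgroup.one_closed[of L "add_monoid MP"] by (auto simp: regular_right_mod_def)
  show "L \<subseteq> P" by (fact L)
  show "y \<otimes> x \<in> L" if "y \<in> L" "x \<in> carrier R" for y x
    by (rule act that)+
  show "fin_supp.subspace L"
  proof (rule fin_supp.subspaceI)
    fix c y assume y: "y \<in> L"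
    then have yc: "y \<in> carrier R" using L(1) P_iff by blast
    have "y \<otimes> scale c \<one> \<in> L"
      using y by (intro act fin_supp.subspace_scale[OF subspace_carrier]) auto
    then show "scale c y \<in> L"
      using yc by simp
  qed (use L in auto)
qed

lemma K_submodule: "right_submodule R MP K"
proof -
  have "additive_subgroup K MP"
    by (rule additive_subgroup_subspace)
      (use P_subspace K_subspace in \<open>auto simp: regular_right_mod_def\<close>)
  moreover have "y \<otimes> x \<in> K" if "y \<in> K" "x \<in> carrier R" for x y
    using that P_act[of y x] P_iff[of y] by auto
  ultimately show ?thesis
    by (simp add: right_submodule_def regular_right_mod_def)
qed

lemma e_in_P: "e \<in> P"
  using e_closed e_idem by (simp only: P_iff)

text \<open>
  A right ideal inside \<open>e R\<close> that is not in the kernel of \<open>\<theta>\<close> contains some \<open>z \<in> e R e\<close>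
  with \<open>\<theta> z = 1\<close>. The idempotent supplied by Fitting's lemma is then nonzero,
  so it is \<open>e\<close> by primitivity.
\<close>

lemma submodule_eq_P:
  assumes "right_submodule R MP L" "y \<in> L" "\<theta> y \<noteq> 0"
  shows "L = P"
proof -
  note L = submoduleD[OF assms(1)]
  have y: "y \<in> carrier R" "e \<otimes> y = y"
    using L(1) assms(2) P_iff by blast+
  define z where "z = scale (1 / \<theta> y) (y \<otimes> e)"
  have zL: "z \<in> L"
    unfolding z_def using L assms(2) e_closed by (intro fin_supp.subspace_scale) auto
  have z: "z \<in> carrier R"
    using zL L(1) P_iff by blast
  have ze: "z \<otimes> e = z" "e \<otimes> z = z"
    using y e_closed e_idem by (simp_all add: z_def m_assoc) (simp flip: m_assoc)
  have char_z: "\<theta> z = 1"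
    using y e_closed assms(3) char_e by (simp add: z_def)
  obtain g a and k :: nat where a: "a \<in> carrier R" and g: "g = z \<otimes> a" "g = a \<otimes> z" "g \<otimes> g = g"
    and zk: "z [^] k \<otimes> g = z [^] k"
    using fitting_idempotent[OF T z] .
  have gc: "g \<in> carrier R"
    using z a g by auto
  have "\<theta> (z [^] k \<otimes> g) = \<theta> (z [^] k)"
    by (simp only: zk)
  then have char_g: "\<theta> g = 1"
    using z gc by (simp add: char_power char_z)
  have eg: "e \<otimes> g = g"
    unfolding g(1) using ze z a e_closed by (simp flip: m_assoc)
  have ge: "g \<otimes> e = g"
    unfolding g(2) using ze z a e_closed by (simp add: m_assoc)
  have "g = e"
  proof (rule ccontr)
    assume "g \<noteq> e"
    let ?f = "e - g"
    have f: "?f \<in> carrier R"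
      using subspace_carrier e_closed gc by (rule_tac fin_supp.subspace_diff)
    have fg: "?f \<otimes> g = 0" "g \<otimes> ?f = 0" "?f \<otimes> ?f = ?f"
    proof -
      show "?f \<otimes> g = 0"
        using l_distr[OF f gc gc] g(3) eg by simp
      show "g \<otimes> ?f = 0"
        using r_distr[OF f gc gc] g(3) ge by simp
      then show "?f \<otimes> ?f = ?f"
        using l_distr[OF f gc f] r_distr[OF f gc e_closed] eg e_idem
        by (simp add: eq_diff_eq)
    qed
    have "g \<noteq> 0"
      using char_g char_minus[OF gc gc] by auto
    then show False
      using e f fg gc g(3) \<open>g \<noteq> e\<close> unfolding primitive_idempotent_def
      by (metis add_eq diff_add_cancel eq_iff_diff_eq_0 add.commute zero_eq)
  qed
  then have "e \<in> L"
    using g(1) L(3)[OF zL a] by simp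
  then have "P \<subseteq> L"
    using L(3) by blast
  with L(1) show ?thesis by blast
qed

lemma rad_eq: "rad R MP = K"
proof -
  have e: "e \<notin> K"
    using char_e by simp
  have carr: "carrier MP = P"
    by simp
  have "maximal_right_submodule R MP N \<longleftrightarrow> N = K" for N
  proof
    assume N: "maximal_right_submodule R MP N"
    then have sub: "right_submodule R MP N" and ne: "N \<noteq> P"
      by (auto simp: maximal_right_submodule_def)
    have "N \<subseteq> K"
      using submodule_eq_P[OF sub] submoduleD(1)[OF sub] ne by blast
    moreover have "K \<noteq> P"
      using e e_in_P by blast
    ultimately show "N = K"
      using N K_submodule unfolding maximal_right_submodule_def carr by blast
  next
    assume "N = K"
    have "L = K \<or> L = P" if "right_submodule R MP L" "K \<subseteq> L" for L
      using submodule_eq_P[OF that(1)] submoduleD(1)[OF that(1)] that(2) by blast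
    moreover have "K \<noteq> P"
      using e e_in_P by blast
    ultimately show "maximal_right_submodule R MP N"
      using K_submodule unfolding maximal_right_submodule_def carr \<open>N = K\<close> by blast
  qed
  then have "{N. maximal_right_submodule R MP N} = {K}"
    by blast
  then show ?thesis
    unfolding rad_def carr by auto
qed

text \<open>The cosets of \<open>K\<close> in \<open>P\<close> are the fibres of
  \<open>\<theta>\<close>, so the quotient, like \<open>V\<close>, is a line on which
  \<open>x\<close> acts by the scalar \<open>\<theta> x\<close>.\<close>

lemma isomorphic_top:
  fixes V :: "('a \<Rightarrow>\<^sub>0 complex, 'b \<Rightarrow>\<^sub>0 complex, 'y) right_mod_scheme"
  assumes "carrier V = range (\<lambda>c. scale c s)" "s \<noteq> 0" "\<And>v w. v \<oplus>\<^bsub>V\<^esub> w = v + w"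
    and act: "\<And>v x. v \<in> carrier V \<Longrightarrow> x \<in> carrier R \<Longrightarrow> v \<triangleleft>\<^bsub>V\<^esub> x = scale (\<theta> x) v"
  shows "right_mod_isomorphic R V (quot_right_mod MP (rad R MP))"
proof -
  define fib where "fib c = {y \<in> P. \<theta> y = c}" for c
  have PR: "x \<in> P \<Longrightarrow> x \<in> carrier R" for x
    using P_iff by blast
  have scale_e: "scale c e \<in> fib c" for c
    using e_in_P fin_supp.subspace_scale[OF P_subspace, of e c] e_closed char_e
    by (simp add: fib_def)
  have coset: "K +>\<^bsub>MP\<^esub> y = fib (\<theta> y)" if y: "y \<in> P" for y
  proof -
    have "k + y \<in> fib (\<theta> y)" if "k \<in> K" for k
      using that y fin_supp.subspace_add[OF P_subspace, of k y] PR[of y] PR[of k]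
      by (auto simp: fib_def)
    moreover have "\<exists>k\<in>K. x = k + y" if "x \<in> fib (\<theta> y)" for x
    proof (intro bexI)
      show "x - y \<in> K"
        using that y fin_supp.subspace_diff[OF P_subspace, of x y] PR[of y] PR[of x] char_minus
        by (auto simp: fib_def)
    qed simp
    ultimately show ?thesis
      by (auto simp: a_r_coset_def' regular_right_mod_def)
  qed
  have scale_inj: "scale c s = scale d s \<longleftrightarrow> c = d" for c d
    using assms(2) by simp
  \<comment> \<open>The coordinate along \<open>s\<close>, unique because \<open>s\<close> is
    nonzero and used only on multiples of \<open>s\<close>.\<close>
  define cf where "cf v = (THE c. v = scale c s)" for v
  have cf [simp]: "cf (scale c s) = c" for c
    unfolding cf_def by (rule the_equality) (use assms(2) in auto)
  have "(\<lambda>v. fib (cf v)) \<in> right_mod_iso R V (quot_right_mod MP (rad R MP))"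
    unfolding right_mod_iso_def
  proof (intro CollectI conjI ballI)
    show "bij_betw (\<lambda>v. fib (cf v)) (carrier V) (carrier (quot_right_mod MP (rad R MP)))"
    proof (rule bij_betw_imageI)
      have "c = d" if "fib c = fib d" for c d
        using scale_e[of c] scale_e[of c, unfolded that] unfolding fib_def by auto
      then show "inj_on (\<lambda>v. fib (cf v)) (carrier V)"
        by (auto simp: inj_on_def assms(1))
      have "carrier (quot_right_mod MP (rad R MP)) = (\<lambda>y. fib (\<theta> y)) ` P"
        using coset by (auto simp: quot_right_mod_def A_RCOSETS_def' rad_eq)
      also have "\<dots> = range fib"
      proof -
        have "fib c = fib (\<theta> (scale c e)) \<and> scale c e \<in> P" for c
          using scale_e[of c] unfolding fib_def by auto
        then show ?thesis by blast
      qed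
      finally show "(\<lambda>v. fib (cf v)) ` carrier V = carrier (quot_right_mod MP (rad R MP))"
        by (auto simp: assms(1) image_image)
    qed
  next
    fix v w assume "v \<in> carrier V" "w \<in> carrier V"
    then obtain c d where vw: "v = scale c s" "w = scale d s"
      by (auto simp: assms(1))
    have "fib (c + d) = {x + y | x y. x \<in> fib c \<and> y \<in> fib d}"
    proof safe
      fix x assume x: "x \<in> fib (c + d)"
      have "x - scale d e \<in> fib c"
        using x scale_e[of d] fin_supp.subspace_diff[OF P_subspace, of x "scale d e"]
          char_minus[of x "scale d e"] PR[of x] PR[of "scale d e"] by (auto simp: fib_def)
      then show "\<exists>y z. x = y + z \<and> y \<in> fib c \<and> z \<in> fib d"
        using scale_e[of d] by (intro exI[of _ "x - scale d e"] exI[of _ "scale d e"]) auto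
    next
      fix x y assume "x \<in> fib c" "y \<in> fib d"
      then show "x + y \<in> fib (c + d)"
        using fin_supp.subspace_add[OF P_subspace, of x y] PR[of x] PR[of y] by (auto simp: fib_def)
    qed
    moreover have "cf (v + w) = c + d"
      by (simp add: vw flip: fin_supp.scale_left_distrib)
    ultimately show "fib (cf (v \<oplus>\<^bsub>V\<^esub> w))
        = fib (cf v) \<oplus>\<^bsub>quot_right_mod MP (rad R MP)\<^esub> fib (cf w)"
      by (auto simp: assms(3) vw quot_right_mod_def set_add_defs regular_right_mod_def)
  next
    fix v x assume v: "v \<in> carrier V" and x: "x \<in> carrier R"
    then obtain c where c: "v = scale c s"
      by (auto simp: assms(1))
    have "K +>\<^bsub>MP\<^esub> (m \<otimes> x) = fib (\<theta> x * c)" if "m \<in> fib c" for m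
      using that x coset[of "m \<otimes> x"] P_act[of m x] PR[of m] by (auto simp: fib_def mult.commute)
    \<comment> \<open>The quotient action is a union over representatives. They all give the same
      fibre, and \<open>scale c e\<close> shows that the union is not empty.\<close>
    then have "(\<Union>m\<in>fib c. K +>\<^bsub>MP\<^esub> (m \<otimes> x)) = fib (\<theta> x * c)"
      using scale_e[of c] by blast
    moreover have "cf (v \<triangleleft>\<^bsub>V\<^esub> x) = \<theta> x * c"
      using act[OF v x] by (simp add: c)
    ultimately show "fib (cf (v \<triangleleft>\<^bsub>V\<^esub> x))
        = fib (cf v) \<triangleleft>\<^bsub>quot_right_mod MP (rad R MP)\<^esub> x"
      unfolding quot_right_mod_def rad_eq by (simp add: c regular_right_mod_def)
  qed
  then show ?thesis
    unfolding right_mod_isomorphic_def by blast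
qed

end

end


section \<open>Faces and permutations\<close>

text \<open>A repeated nonempty block is not disjoint from itself, so
  \<open>sorted_wrt disjnt\<close> covers distinctness too, in a form suited to induction on the
  list.\<close>

lemma faces_iff:
  "f \<in> faces n \<longleftrightarrow> {} \<notin> set f \<and> sorted_wrt disjnt f \<and> \<Union> (set f) = {1..n}"
proof -
  have "distinct f \<and> disjoint (set f) \<longleftrightarrow> sorted_wrt disjnt f" if "{} \<notin> set f"
    using that
  proof (induction f)
    case (Cons P f)
    then show ?case
      by (auto simp: pairwise_insert disjnt_sym)
  qed simp
  then show ?thesis
    by (auto simp: faces_def partition_on_def)
qed

text \<open>This is the one-line notation of the permutation \<open>\<pi>\<^sub>f\<close>:
  multiplication by the identity chamber lists every block increasingly.\<close>

definition face_word :: "nat set list \<Rightarrow> nat list" where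
  "face_word f = concat (map sorted_list_of_set f)"

text \<open>The shift reconciles list positions, which start at 0, with points, which start at 1;
  outside the range it is the identity, as \<open>permutes\<close> demands.\<close>

definition face_perm :: "nat set list \<Rightarrow> nat \<Rightarrow> nat" where
  "face_perm f i = (if i \<in> {1..length (face_word f)} then face_word f ! (i - 1) else i)"

definition chamber :: "nat \<Rightarrow> (nat \<Rightarrow> nat) \<Rightarrow> nat set list" where
  "chamber n p = map (\<lambda>i. {p i}) [1..<Suc n]"

lemma finite_block: "f \<in> faces n \<Longrightarrow> P \<in> set f \<Longrightarrow> finite P"
  by (rule finite_subset[of _ "{1..n}"]) (auto simp: faces_iff)

lemma finite_faces: "finite (faces n)"
proof (rule finite_subset)
  show "faces n \<subseteq> {f. set f \<subseteq> Pow {1..n} \<and> distinct f}"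
    by (auto simp: faces_def partition_on_def)
  show "finite {f. set f \<subseteq> Pow {1..n} \<and> distinct f}"
    by (rule finite_subset_distinct) simp
qed

lemma faces_iff_word:
  "f \<in> faces n \<longleftrightarrow> {} \<notin> set f \<and> (\<forall>P\<in>set f. finite P) \<and> distinct (face_word f) \<and>
     set (face_word f) = {1..n}"
proof -
  have "sorted_wrt disjnt f \<longleftrightarrow> distinct (face_word f)"
    if "\<forall>P\<in>set f. finite P"
    using that by (induction f) (auto simp: face_word_def disjnt_def)
  moreover have "set (face_word f) = \<Union> (set f)" if "\<forall>P\<in>set f. finite P"
    using that by (auto simp: face_word_def)
  ultimately show ?thesis
    using finite_block[of f n] by (auto simp: faces_iff)
qed

lemma length_face_word: "f \<in> faces n \<Longrightarrow> length (face_word f) = n"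
  using distinct_card[of "face_word f"] by (simp add: faces_iff_word)

lemma face_perm_permutes:
  assumes "f \<in> faces n"
  shows "face_perm f permutes {1..n}"
proof (rule bij_imp_permutes)
  have "bij_betw ((!) (face_word f)) {..<n} {1..n}"
    using bij_betw_nth[of "face_word f", OF _ refl refl] length_face_word[OF assms] assms
    unfolding faces_iff_word by metis
  moreover have "bij_betw (\<lambda>i. i - 1) {1..n} {..<n}"
    by (rule bij_betwI[of _ _ _ Suc]) auto
  ultimately have "bij_betw ((!) (face_word f) \<circ> (\<lambda>i. i - 1)) {1..n} {1..n}"
    by (rule_tac bij_betw_trans)
  then show "bij_betw (face_perm f) {1..n} {1..n}"
    by (rule bij_betw_cong[THEN iffD1, rotated])
      (auto simp: face_perm_def length_face_word[OF assms])
qed (auto simp: face_perm_def length_face_word[OF assms])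

lemma map_face_perm: "f \<in> faces n \<Longrightarrow> map (face_perm f) [1..<Suc n] = face_word f"
  by (rule nth_equalityI) (auto simp: face_perm_def length_face_word simp del: upt_Suc)

lemma face_perm_eqI:
  assumes "f \<in> faces n" "p permutes {1..n}" "face_word f = map p [1..<Suc n]"
  shows "face_perm f = p"
proof
  fix i
  show "face_perm f i = p i"
  proof (cases "i \<in> {1..n}")
    case True
    have "map (face_perm f) [1..<Suc n] = map p [1..<Suc n]"
      using assms map_face_perm by simp
    then show ?thesis
      using True unfolding map_eq_conv by (simp del: upt_Suc)
  next
    case False
    then show ?thesis
      using assms face_perm_permutes by (metis permutes_not_in)
  qed
qed

lemma chamber_eq_iff:
  assumes "p permutes {1..n}" "q permutes {1..n}"
  shows "chamber n p = chamber n q \<longleftrightarrow> p = q"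
proof
  assume eq: "chamber n p = chamber n q"
  show "p = q"
  proof
    fix i
    show "p i = q i"
      using eq assms by (cases "i \<in> {1..n}") (auto simp: chamber_def permutes_not_in simp del: upt_Suc)
  qed
qed simp

lemma chamber_in_faces:
  assumes "p permutes {1..n}"
  shows "chamber n p \<in> faces n"
proof -
  have "face_word (chamber n p) = map p [1..<Suc n]"
    by (simp add: face_word_def chamber_def comp_def concat_map_singleton del: upt_Suc)
  moreover have "p ` {1..<Suc n} = {1..n}"
    using permutes_image[OF assms] by (simp add: atLeastLessThanSuc_atLeastAtMost)
  ultimately show ?thesis
    using permutes_inj[OF assms]
    by (auto simp: faces_iff_word chamber_def distinct_map inj_on_def simp del: upt_Suc)
qed

lemma map_image_chamber: "map (image w) (chamber n p) = chamber n (w \<circ> p)"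
  by (simp add: chamber_def)

section \<open>The product of faces\<close>

lemma face_mult_Nil [simp]: "face_mult [] g = []"
  by (simp add: face_mult_def)

lemma face_mult_Cons:
  "face_mult (P # f) g = filter (\<lambda>B. B \<noteq> {}) (map ((\<inter>) P) g) @ face_mult f g"
  by (simp add: face_mult_def)

lemma face_mult_append: "face_mult (f @ f') g = face_mult f g @ face_mult f' g"
  by (simp add: face_mult_def)

text \<open>Intersecting a block with the singletons in their natural order leaves its elements in
  increasing order.\<close>

lemma face_mult_chamber:
  assumes "f \<in> faces n"
  shows "face_mult f (chamber n id) = chamber n (face_perm f)"
proof -
  have "filter (\<lambda>B. B \<noteq> {}) (map ((\<inter>) P) (map (\<lambda>i. {i}) xs)) = map (\<lambda>i. {i}) (filter (\<lambda>i. i \<in> P) xs)"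
    for P and xs :: "nat list"
    by (induction xs) auto
  moreover have "filter (\<lambda>i. i \<in> P) [1..<Suc n] = sorted_list_of_set P" if "P \<in> set f" for P
  proof -
    have "P \<subseteq> {1..n}"
      using that assms unfolding faces_iff by blast
    then have "set (filter (\<lambda>i. i \<in> P) [1..<Suc n]) = P"
      by auto
    then show ?thesis
      using sorted_list_of_set.idem_if_sorted_distinct[of "filter (\<lambda>i. i \<in> P) [1..<Suc n]"]
      by (simp add: sorted_wrt_filter del: upt_Suc)
  qed
  ultimately have "face_mult f (chamber n id) = concat (map (\<lambda>P. map (\<lambda>i. {i}) (sorted_list_of_set P)) f)"
    unfolding face_mult_def chamber_def filter_concat
    by (auto simp: comp_def simp del: upt_Suc filter_map intro!: arg_cong[of _ _ concat] map_cong)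
  also have "\<dots> = map (\<lambda>i. {i}) (face_word f)"
    by (simp add: face_word_def map_concat comp_def)
  also have "\<dots> = chamber n (face_perm f)"
    by (simp add: chamber_def flip: map_face_perm[OF assms])
  finally show ?thesis .
qed

text \<open>Associativity for a single block of the first factor: an intersection that is already
  empty contributes nothing whether it is discarded early or late.\<close>

lemma filter_Int_face_mult:
  "filter (\<lambda>B. B \<noteq> {}) (map ((\<inter>) P) (face_mult g h))
     = face_mult (filter (\<lambda>B. B \<noteq> {}) (map ((\<inter>) P) g)) h"
proof (induction g)
  case (Cons Q g)
  have "filter (\<lambda>B. B \<noteq> {}) (map ((\<inter>) P) (filter (\<lambda>B. B \<noteq> {}) (map ((\<inter>) Q) h)))
      = filter (\<lambda>B. B \<noteq> {}) (map ((\<inter>) (P \<inter> Q)) h)"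
    by (induction h) auto
  moreover have "filter (\<lambda>B. B \<noteq> {}) (map ((\<inter>) {}) h) = []"
    by (induction h) auto
  ultimately show ?case
    using Cons by (auto simp: face_mult_Cons simp del: filter_map)
qed simp

lemma face_mult_assoc: "face_mult (face_mult f g) h = face_mult f (face_mult g h)"
  by (induction f) (simp_all add: face_mult_Cons face_mult_append filter_Int_face_mult)

lemma set_face_mult: "set (face_mult f g) = {P \<inter> Q | P Q. P \<in> set f \<and> Q \<in> set g} - {{}}"
  by (auto simp: face_mult_def)

lemma face_mult_closed:
  assumes "f \<in> faces n" "g \<in> faces n"
  shows "face_mult f g \<in> faces n"
proof -
  have "sorted_wrt disjnt (face_mult f g)"
    if "sorted_wrt disjnt f" "sorted_wrt disjnt g"
    using that(1)
  proof (induction f)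
    case (Cons P f)
    have "sorted_wrt disjnt (filter (\<lambda>B. B \<noteq> {}) (map ((\<inter>) P) g))"
      using that(2) unfolding sorted_wrt_map
      by (intro sorted_wrt_filter) (auto simp: sorted_wrt_map disjnt_def
          elim!: sorted_wrt_mono_rel[rotated])
    then show ?case
      using Cons by (auto simp: face_mult_Cons sorted_wrt_append set_face_mult)
        (auto simp: disjnt_def)
  qed simp
  moreover have "\<Union> (set (face_mult f g)) = \<Union> (set f) \<inter> \<Union> (set g)"
    by (auto simp: set_face_mult)
  ultimately show ?thesis
    using assms by (simp add: faces_iff) (auto simp: set_face_mult)
qed

lemma face_mult_map_image:
  assumes "inj p"
  shows "face_mult (map (image p) f) (map (image p) g) = map (image p) (face_mult f g)"
proof (induction f)
  case (Cons P f)
  have "filter (\<lambda>B. B \<noteq> {}) (map ((\<inter>) (p ` P)) (map (image p) g))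
      = map (image p) (filter (\<lambda>B. B \<noteq> {}) (map ((\<inter>) P) g))"
    by (induction g) (auto simp flip: image_Int[OF assms])
  with Cons show ?case
    by (simp add: face_mult_Cons del: map_map)
qed simp

lemma map_image_in_faces:
  assumes "p permutes {1..n}" "f \<in> faces n"
  shows "map (image p) f \<in> faces n"
proof -
  have "\<Union> (image p ` set f) = p ` \<Union> (set f)" by blast
  moreover have "disjnt (p ` A) (p ` B) \<longleftrightarrow> disjnt A B" for A B
    using permutes_inj[OF assms(1)] by (auto simp: disjnt_def inj_def)
  ultimately show ?thesis
    using assms permutes_image[OF assms(1)]
    by (auto simp: faces_iff sorted_wrt_map)
qed

lemma unit_face_in_faces: "n \<ge> 1 \<Longrightarrow> [{1..n}] \<in> faces n"
  by (auto simp: faces_iff)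

lemma face_monoid: 
  assumes "n \<ge> 1"
  shows "monoid (face_monoid n)"
proof
  fix f assume f: "f \<in> carrier (face_monoid n)"
  have *: "filter (\<lambda>B. B \<noteq> {}) f = f"
    using f by (auto simp: face_monoid_def faces_iff intro!: filter_True)
  have "map ((\<inter>) {1..n}) f = f"
    using f by (intro map_idI) (auto simp: face_monoid_def faces_iff)
  then show "\<one>\<^bsub>face_monoid n\<^esub> \<otimes>\<^bsub>face_monoid n\<^esub> f = f"
    using * by (simp add: face_monoid_def face_mult_Cons)
  have "map (\<lambda>P. P \<inter> {1..n}) f = f"
    using f by (intro map_idI) (auto simp: face_monoid_def faces_iff)
  then show "f \<otimes>\<^bsub>face_monoid n\<^esub> \<one>\<^bsub>face_monoid n\<^esub> = f"
    using * by (simp add: face_monoid_def face_mult_def)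
qed (use assms in \<open>auto simp: face_monoid_def face_mult_closed face_mult_assoc unit_face_in_faces[simplified]\<close>)

text \<open>Both sides are determined by their action on the chamber of the identity.\<close>

lemma face_perm_face_mult:
  assumes "f \<in> faces n" "g \<in> faces n"
  shows "face_perm (face_mult (map (image (face_perm g)) f) g) = face_perm g \<circ> face_perm f"
proof -
  let ?p = "face_perm g"
  note p = face_perm_permutes[OF assms(2)]
  note pf = map_image_in_faces[OF p assms(1)]
  note h = face_mult_closed[OF pf assms(2)]
  have "chamber n (face_perm (face_mult (map (image ?p) f) g))
      = face_mult (map (image ?p) f) (face_mult g (chamber n id))"
    by (simp add: face_mult_chamber[OF h, symmetric] face_mult_assoc)
  also have "face_mult g (chamber n id) = map (image ?p) (chamber n id)"
    by (simp add: face_mult_chamber[OF assms(2)] map_image_chamber)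
  also have "face_mult (map (image ?p) f) \<dots> = chamber n (?p \<circ> face_perm f)"
    unfolding face_mult_map_image[OF permutes_inj[OF p]] face_mult_chamber[OF assms(1)]
    by (rule map_image_chamber)
  finally show ?thesis
    using face_perm_permutes[OF h] permutes_compose[OF face_perm_permutes[OF assms(1)] p]
    by (simp add: chamber_eq_iff)
qed

section \<open>Positions of the blocks in the word of a face\<close>

fun segments :: "nat \<Rightarrow> nat list \<Rightarrow> nat list list" where
  "segments a [] = []"
| "segments a (c # cs) = [Suc a..<Suc (a + c)] # segments (a + c) cs"

lemma map_length_segments [simp]: "map length (segments a cs) = cs"
  by (induction cs arbitrary: a) simp_all

lemma concat_segments: "concat (segments a cs) = [Suc a..<Suc (a + sum_list cs)]"
proof (induction cs arbitrary: a)
  case (Cons c cs)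
  then show ?case
    using upt_add_eq_append[of "Suc a" "Suc (a + c)" "sum_list cs"]
    by (simp add: add.assoc del: upt_Suc)
qed simp

lemma set_segments_gt: "s \<in> set (segments a cs) \<Longrightarrow> i \<in> set s \<Longrightarrow> a < i"
  by (induction cs arbitrary: a) fastforce+

lemma sorted_wrt_segments:
  "sorted_wrt (\<lambda>s t. \<forall>x\<in>set s. \<forall>y\<in>set t. x < y) (segments a cs)"
  by (induction cs arbitrary: a) (auto dest: set_segments_gt)

text \<open>The prefix \<open>pre\<close> is there for the induction: it takes up the lists already
  read, and its length is the current offset.\<close>

lemma map_nth_segments:
  assumes "map length xss = cs"
  shows "map (map (\<lambda>i. (pre @ concat xss) ! (i - 1))) (segments (length pre) cs) = xss"
  using assms
proof (induction xss arbitrary: pre cs)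
  case (Cons xs xss)
  have "map (\<lambda>i. (pre @ xs @ concat xss) ! (i - 1))
      [Suc (length pre)..<Suc (length pre + length xs)] = xs"
    by (rule nth_equalityI) (auto simp: nth_append simp del: upt_Suc)
  then show ?case
    using Cons.IH[of "map length xss" "pre @ xs"] Cons.prems by (auto simp del: upt_Suc)
qed simp

lemma map_face_perm_segments:
  assumes "f \<in> faces n"
  shows "map (map (face_perm f)) (segments 0 (map card f)) = map sorted_list_of_set f"
proof -
  have "map length (map sorted_list_of_set f) = map card f"
    by simp
  from map_nth_segments[OF this, of "[]"]
  have "map (map (\<lambda>i. face_word f ! (i - 1))) (segments 0 (map card f)) = map sorted_list_of_set f"
    by (simp add: face_word_def)
  moreover have "sum_list (map card f) = n"
  proof -
    have "sum_list (map card f) = length (face_word f)"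
      by (simp add: face_word_def length_concat comp_def)
    then show ?thesis
      using assms by (simp add: length_face_word)
  qed
  then have "face_perm f i = face_word f ! (i - 1)"
    if "s \<in> set (segments 0 (map card f))" "i \<in> set s" for s i
  proof -
    have "i \<in> set (concat (segments 0 (map card f)))"
      using that by auto
    then show ?thesis
      using length_face_word[OF assms] \<open>sum_list _ = n\<close> 
      by (auto simp: concat_segments face_perm_def simp del: upt_Suc set_concat)
  qed
  ultimately show ?thesis
    by (metis (no_types, lifting) map_cong)
qed

text \<open>A face is recovered from its permutation and its type, so \<open>face_perm\<close> is
  injective on the faces of a given type.\<close>

lemma face_eq_map_segments:
  assumes "f \<in> faces n"
  shows "f = map (\<lambda>s. face_perm f ` set s) (segments 0 (map card f))"
proof -
  have "map set (map sorted_list_of_set f) = f"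
    using finite_block[OF assms] by (auto intro: map_idI)
  then show ?thesis
    unfolding map_face_perm_segments[OF assms, symmetric] by (simp add: comp_def)
qed

text \<open>Both faces are images of the same segments, so \<open>face_perm g\<close> composed with
  the inverse of \<open>face_perm f\<close> works. The faces of one type thus form a single
  orbit.\<close>

lemma ex_perm_same_type:
  assumes "f \<in> faces n" "g \<in> faces n" "map card f = map card g"
  obtains p where "p permutes {1..n}" "g = map (image p) f"
proof
  let ?f = "face_perm f" and ?g = "face_perm g"
  have f: "?f permutes {1..n}" and g: "?g permutes {1..n}"
    by (intro face_perm_permutes assms)+
  show "?g \<circ> inv' ?f permutes {1..n}"
    by (intro permutes_compose permutes_inv f g)
  have "map (image (?g \<circ> inv' ?f)) f = map (\<lambda>s. (?g \<circ> (inv' ?f \<circ> ?f)) ` set s) (segments 0 (map card f))"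
    by (subst face_eq_map_segments[OF assms(1)]) (simp add: image_image)
  also have "\<dots> = g"
    using face_eq_map_segments[OF assms(2)] assms(3) by (simp add: permutes_inv_o[OF f])
  finally show "g = map (image (?g \<circ> inv' ?f)) f" ..
qed

text \<open>The last two claims say that consecutive positions share a segment exactly when no cut
  lies between them. The start \<open>a\<close> is arbitrary for the sake of the induction.\<close>

lemma segments_composition:
  assumes "sorted_wrt (<) (a # js @ [m])"
  defines "cs \<equiv> map2 (-) (js @ [m]) (a # js)"
  shows "0 \<notin> set cs" "a + sum_list cs = m"
    "\<And>s i. s \<in> set (segments a cs) \<Longrightarrow> i \<in> set s \<Longrightarrow> Suc i \<in> set s \<Longrightarrow> i \<notin> set js"
    "\<And>i. a < i \<Longrightarrow> i < m \<Longrightarrow> i \<notin> set js \<Longrightarrow> \<exists>s\<in>set (segments a cs). i \<in> set s \<and> Suc i \<in> set s"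
  using assms(1) unfolding cs_def
proof (induction js arbitrary: a)
  case (Cons j js)
  { case 1 then show ?case using Cons.IH(1)[of j] by auto }
  { case 2 then show ?case using Cons.IH(2)[of j] by auto }
  { case (3 s i)
    have "a + (j - a) = j" using 3(4) by auto
    then have seg: "segments a (map2 (-) ((j # js) @ [m]) (a # j # js))
        = [Suc a..<Suc j] # segments j (map2 (-) (js @ [m]) (j # js))" by simp
    consider "s = [Suc a..<Suc j]" | "s \<in> set (segments j (map2 (-) (js @ [m]) (j # js)))"
      using 3(1) unfolding seg by auto
    then show ?case
    proof cases
      case 1
      then show ?thesis using 3 by auto
    next
      case 2
      then show ?thesis
        using Cons.IH(3)[OF 2] 3 set_segments_gt[OF 2, of i] by auto
    qed }
  { case (4 i)
    have "a + (j - a) = j" using 4(4) by auto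
    then have seg: "segments a (map2 (-) ((j # js) @ [m]) (a # j # js))
        = [Suc a..<Suc j] # segments j (map2 (-) (js @ [m]) (j # js))" by simp
    consider "i < j" | "j < i"
      using 4(3) by fastforce
    then show ?case
    proof cases
      case 1
      then show ?thesis unfolding seg using 4 by auto
    next
      case 2
      then show ?thesis unfolding seg using Cons.IH(4)[where a = j and i = i] 4 by auto
    qed }
qed auto


section \<open>Descents and composition types\<close>

context
  fixes n :: nat and J :: "nat set"
  assumes n: "n \<ge> 1" and J: "J \<subseteq> {1..<n}"
begin

lemma sorted_composition: "sorted_wrt (<) (0 # sorted_list_of_set J @ [n])"
  using J n finite_subset[OF J] by (auto simp: sorted_wrt_append)

lemma composition_of_pos: "0 \<notin> set (composition_of n J)"
  and sum_list_composition_of: "sum_list (composition_of n J) = n"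
  and segments_composition_of_D:
    "\<And>s i. s \<in> set (segments 0 (composition_of n J)) \<Longrightarrow> i \<in> set s \<Longrightarrow> Suc i \<in> set s \<Longrightarrow> i \<notin> J"
  and segments_composition_of_E:
    "\<And>i. i \<in> {1..<n} \<Longrightarrow> i \<notin> J \<Longrightarrow>
       \<exists>s\<in>set (segments 0 (composition_of n J)). i \<in> set s \<and> Suc i \<in> set s"
  using segments_composition[OF sorted_composition] finite_subset[OF J]
  by (auto simp: composition_of_def)

end

lemma segments_form: "s \<in> set (segments a cs) \<Longrightarrow> \<exists>x c. s = [Suc x..<Suc (x + c)]"
  by (induction cs arbitrary: a) fastforce+

lemma sorted_wrt_upt_iff: "sorted_wrt R [u..<v] \<longleftrightarrow> (\<forall>i j. u \<le> i \<and> i < j \<and> j < v \<longrightarrow> R i j)"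
proof
  assume R: "sorted_wrt R [u..<v]"
  show "\<forall>i j. u \<le> i \<and> i < j \<and> j < v \<longrightarrow> R i j"
  proof (intro allI impI)
    fix i j assume ij: "u \<le> i \<and> i < j \<and> j < v"
    then have "R ([u..<v] ! (i - u)) ([u..<v] ! (j - u))"
      by (intro sorted_wrt_nth_less[OF R]) auto
    moreover have "[u..<v] ! (i - u) = i" "[u..<v] ! (j - u) = j"
      using ij by (auto simp: nth_upt)
    ultimately show "R i j" by simp
  qed
qed (auto simp: sorted_wrt_iff_nth_less)

text \<open>Within a segment the permutation lists one block increasingly, so it can descend only at
  a cut.\<close>

lemma descents_face_perm:
  assumes n: "n \<ge> 1" and J: "J \<subseteq> {1..<n}" and f: "f \<in> faces n" "map card f = composition_of n J"
  shows "descents n (face_perm f) \<subseteq> J"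
proof
  fix i assume i: "i \<in> descents n (face_perm f)"
  show "i \<in> J"
  proof (rule ccontr)
    assume "i \<notin> J"
    then obtain s where s: "s \<in> set (segments 0 (map card f))" "i \<in> set s" "Suc i \<in> set s"
      using segments_composition_of_E[OF n J, of i] i f(2) by (auto simp: descents_def)
    then have "map (face_perm f) s \<in> set (map sorted_list_of_set f)"
      by (simp flip: map_face_perm_segments[OF f(1)])
    then have "sorted_wrt (\<lambda>x y. face_perm f x < face_perm f y) s"
      by (auto simp flip: sorted_wrt_map)
    moreover obtain x c where "s = [Suc x..<Suc (x + c)]"
      using segments_form[OF s(1)] by blast
    ultimately have "face_perm f i < face_perm f (Suc i)"
      using s(2,3) by (auto simp: sorted_wrt_upt_iff simp del: upt_Suc)
    then show False
      using i by (simp add: descents_def)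
  qed
qed

text \<open>Cut the word of \<open>p\<close> at \<open>J\<close>. No piece contains a descent, so
  each is increasing and is recovered from its underlying set.\<close>

lemma face_of_perm:
  assumes n: "n \<ge> 1" and J: "J \<subseteq> {1..<n}" and p: "p permutes {1..n}" "descents n p \<subseteq> J"
  obtains f where "f \<in> faces n" "map card f = composition_of n J" "face_perm f = p"
proof
  let ?ss = "segments 0 (composition_of n J)"
  define f where "f = map (\<lambda>s. p ` set s) ?ss"
  have conc: "concat ?ss = [1..<Suc n]"
    by (simp add: concat_segments sum_list_composition_of[OF n J] del: upt_Suc)
  have inj: "inj p"
    using p(1) by (rule permutes_inj)
  have sorted: "sorted_list_of_set (p ` set s) = map p s" if s: "s \<in> set ?ss" for s
  proof -
    obtain x c where xc: "s = [Suc x..<Suc (x + c)]"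
      using segments_form[OF s] by blast
    have "p i < p (Suc i)" if "i \<in> set s" "Suc i \<in> set s" for i
    proof -
      have "{i, Suc i} \<subseteq> set (concat ?ss)"
        using s that by auto
      then have "i \<in> {1..<n}"
        unfolding conc by auto
      moreover have "i \<notin> descents n p"
        using segments_composition_of_D[OF n J s that] p(2) by blast
      moreover have "p i \<noteq> p (Suc i)"
        using injD[OF inj, of i "Suc i"] by auto
      ultimately show ?thesis
        by (simp add: descents_def)
    qed
    then have "sorted_wrt (<) (map p s)"
      by (subst sorted_wrt_iff_nth_Suc_transp) (auto simp: xc simp del: upt_Suc)
    then show ?thesis
      using sorted_list_of_set.idem_if_sorted_distinct[of "map p s"]
      by (simp add: strict_sorted_iff)
  qed
  have word: "face_word f = map p [1..<Suc n]"
    unfolding face_word_def f_def conc[symmetric] map_concat map_map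
    by (intro arg_cong[of _ _ concat] map_cong) (auto simp: sorted)
  have dist: "distinct s" if "s \<in> set ?ss" for s
    using segments_form[OF that] by auto
  have "map card f = map length ?ss"
    unfolding f_def map_map
    by (intro map_cong) (auto simp: card_image[OF inj_on_subset[OF inj]] distinct_card dist)
  then show type: "map card f = composition_of n J"
    by simp
  have "{} \<notin> set f"
  proof
    assume "{} \<in> set f"
    then have "card ({} :: nat set) \<in> set (map card f)"
      unfolding set_map by (rule imageI)
    then show False
      unfolding type using composition_of_pos[OF n J] by simp
  qed
  moreover have "set (face_word f) = {1..n}"
    unfolding word using permutes_image[OF p(1)]
    by (simp add: atLeastLessThanSuc_atLeastAtMost del: upt_Suc)
  ultimately show f: "f \<in> faces n"
    unfolding faces_iff_word word
    by (auto simp: f_def distinct_map inj_on_subset[OF inj] simp del: upt_Suc)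
  show "face_perm f = p"
    using f p(1) word by (rule face_perm_eqI)
qed

text \<open>The blocks of the face of type \<open>J\<close> are intervals, arranged in decreasing order.\<close>

lemma ex_perm_descents_eq:
  assumes n: "n \<ge> 1" and J: "J \<subseteq> {1..<n}"
  obtains p where "p permutes {1..n}" "descents n p = J"
proof
  let ?c = "composition_of n J"
  let ?ss = "segments 0 (rev ?c)"
  \<comment> \<open>The two reversals give the blocks the sizes \<open>?c\<close> in this order,
    while every block lies above the next one.\<close>
  define f where "f = rev (map set ?ss)"
  have dist: "distinct s" if "s \<in> set ?ss" for s
    using segments_form[OF that] by auto
  have "map card (map set ?ss) = map length ?ss"
    unfolding map_map by (intro map_cong) (auto simp: distinct_card dist)
  then have type: "map card f = ?c"
    by (simp add: f_def rev_map[symmetric])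
  have sorted: "sorted_wrt (\<lambda>A B. \<forall>a\<in>A. \<forall>b\<in>B. b < a) f"
    unfolding f_def sorted_wrt_rev sorted_wrt_map
    by (rule sorted_wrt_mono_rel[OF _ sorted_wrt_segments]) blast
  have "{} \<notin> set f"
  proof
    assume "{} \<in> set f"
    then have "card ({} :: nat set) \<in> set (map card f)"
      unfolding set_map by (rule imageI)
    then show False
      unfolding type using composition_of_pos[OF n J] by simp
  qed
  moreover have "sorted_wrt disjnt f"
    using sorted by (rule sorted_wrt_mono_rel[rotated]) (auto simp: disjnt_def)
  moreover have "\<Union> (set f) = set (concat ?ss)"
    by (simp add: f_def)
  then have "\<Union> (set f) = {1..n}"
    unfolding concat_segments by (simp add: sum_list_composition_of[OF n J] atLeastLessThanSuc_atLeastAtMost del: upt_Suc)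
  ultimately have f: "f \<in> faces n"
    by (simp add: faces_iff)
  show "face_perm f permutes {1..n}"
    using f by (rule face_perm_permutes)
  show "descents n (face_perm f) = J"
  proof
    show "descents n (face_perm f) \<subseteq> J"
      using n J f type by (rule descents_face_perm)
    show "J \<subseteq> descents n (face_perm f)"
    proof
      fix i assume i: "i \<in> J"
      let ?tt = "segments 0 ?c"
      have "set (concat ?tt) = {1..n}"
        unfolding concat_segments by (simp add: sum_list_composition_of[OF n J] atLeastLessThanSuc_atLeastAtMost del: upt_Suc)
      moreover have "i \<in> {1..n}" "Suc i \<in> {1..n}" and i': "i \<in> {1..<n}"
        using i J by auto
      ultimately obtain k l where k: "k < length ?tt" "i \<in> set (?tt ! k)"
        and l: "l < length ?tt" "Suc i \<in> set (?tt ! l)"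
        by (metis (no_types, lifting) UN_E in_set_conv_nth set_concat)
      have "k \<noteq> l"
        using segments_composition_of_D[OF n J _ k(2)] k l i by auto
      moreover have "\<not> l < k"
        using sorted_wrt_nth_less[OF sorted_wrt_segments, of l k 0 ?c] k l by force
      ultimately have "k < l" by simp
      have fk: "f ! j = face_perm f ` set (?tt ! j)" if "j < length ?tt" for j
        using that by (subst face_eq_map_segments[OF f]) (simp add: type)
      have "length f = length ?tt"
        using face_eq_map_segments[OF f] type by (metis length_map)
      then have "face_perm f (Suc i) < face_perm f i"
        using sorted_wrt_nth_less[OF sorted \<open>k < l\<close>] k l by (auto simp: fk)
      then show "i \<in> descents n (face_perm f)"
        using i' by (simp add: descents_def)
    qed
  qed
qed

text \<open>The cuts are the partial sums of \<open>cs\<close>; the induction runs over an arbitrary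
  starting value \<open>a\<close>.\<close>

lemma ex_composition_of:
  assumes "cs \<noteq> []" "0 \<notin> set cs" "sum_list cs = n"
  obtains J where "J \<subseteq> {1..<n}" "composition_of n J = cs"
proof -
  have "\<exists>js. sorted_wrt (<) (a # js @ [a + sum_list cs]) \<and>
      map2 (-) (js @ [a + sum_list cs]) (a # js) = cs" for a
    using assms(1,2)
  proof (induction cs arbitrary: a)
    case (Cons c cs)
    show ?case
    proof (cases "cs = []")
      case True
      then show ?thesis
        using Cons.prems by (intro exI[of _ "[]"]) auto
    next
      case False
      then obtain js where "sorted_wrt (<) ((a + c) # js @ [a + c + sum_list cs])"
        "map2 (-) (js @ [a + c + sum_list cs]) ((a + c) # js) = cs"
        using Cons.IH[of "a + c"] Cons.prems by auto
      then show ?thesis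
        using Cons.prems by (intro exI[of _ "(a + c) # js"]) (auto simp: add.assoc)
    qed
  qed simp
  from this[of 0] obtain js where js: "sorted_wrt (<) (0 # js @ [n])"
      "map2 (-) (js @ [n]) (0 # js) = cs"
    using assms(3) by auto
  have "sorted_list_of_set (set js) = js"
    using js(1) by (intro sorted_list_of_set.idem_if_sorted_distinct)
      (auto simp: sorted_wrt_append strict_sorted_iff)
  moreover have "set js \<subseteq> {1..<n}"
    using js(1) by (auto simp: sorted_wrt_append Suc_le_eq)
  ultimately show thesis
    using js(2) by (intro that[of "set js"]) (auto simp: composition_of_def)
qed

lemma ex_face_type:
  assumes "n \<ge> 1" "f \<in> faces n"
  obtains J where "J \<subseteq> {1..<n}" "map card f = composition_of n J"
proof -
  have "sum_list (map card f) = length (face_word f)"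
    by (simp add: face_word_def length_concat comp_def)
  then have "sum_list (map card f) = n"
    using assms by (simp add: length_face_word)
  moreover have "0 \<notin> set (map card f)"
    using assms finite_block[OF assms(2)] by (auto simp: faces_iff)
  moreover have "map card f \<noteq> []"
    using assms by (auto simp: faces_iff)
  ultimately show thesis
    using that ex_composition_of by metis
qed

text \<open>This matches the terms of \<open>face_sum n J\<close> with those of
  \<open>x_elt n J\<close>, which is why \<open>face_perm\<close> induces the inverse of Bidigare's
  map.\<close>

lemma bij_betw_face_perm:
  assumes "n \<ge> 1" "J \<subseteq> {1..<n}"
  shows "bij_betw face_perm {f \<in> faces n. map card f = composition_of n J}
           {p. p permutes {1..n} \<and> descents n p \<subseteq> J}"
proof (rule bij_betw_imageI)
  show "inj_on face_perm {f \<in> faces n. map card f = composition_of n J}"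
  proof (rule inj_onI)
    fix f g
    assume f: "f \<in> {f \<in> faces n. map card f = composition_of n J}"
      and g: "g \<in> {f \<in> faces n. map card f = composition_of n J}"
      and eq: "face_perm f = face_perm g"
    have "f = map (\<lambda>s. face_perm f ` set s) (segments 0 (map card f))"
      using f by (intro face_eq_map_segments[of f n]) simp
    also have "\<dots> = map (\<lambda>s. face_perm g ` set s) (segments 0 (map card g))"
      using f g eq by simp
    also have "\<dots> = g"
      using g by (intro face_eq_map_segments[of g n, symmetric]) simp
    finally show "f = g" .
  qed
  show "face_perm ` {f \<in> faces n. map card f = composition_of n J}
      = {p. p permutes {1..n} \<and> descents n p \<subseteq> J}"
  proof (intro equalityI subsetI)
    fix p assume "p \<in> {p. p permutes {1..n} \<and> descents n p \<subseteq> J}"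
    then obtain f where "f \<in> faces n" "map card f = composition_of n J" "face_perm f = p"
      using face_of_perm[OF assms, of p] by blast
    then show "p \<in> face_perm ` {f \<in> faces n. map card f = composition_of n J}"
      by blast
  qed (use descents_face_perm[OF assms] face_perm_permutes in auto)
qed

text \<open>A permutation with descent set exactly \<open>K\<close> comes from a face of type
  \<open>K\<close>. If \<open>K'\<close> yields the same composition, the descents of that face lie
  in \<open>K'\<close> as well.\<close>

lemma composition_of_inject:
  assumes "n \<ge> 1" "J \<subseteq> {1..<n}" "J' \<subseteq> {1..<n}" "composition_of n J = composition_of n J'"
  shows "J = J'"
proof -
  have sub: "K \<subseteq> K'" if K: "K \<subseteq> {1..<n}" "K' \<subseteq> {1..<n}" "composition_of n K = composition_of n K'"
    for K K'
  proof -
    obtain p where p: "p permutes {1..n}" "descents n p = K"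
      using ex_perm_descents_eq[OF assms(1) K(1)] .
    then obtain f where "f \<in> faces n" "map card f = composition_of n K" "face_perm f = p"
      using face_of_perm[OF assms(1) K(1)] by blast
    then show "K \<subseteq> K'"
      using descents_face_perm[OF assms(1) K(2), of f] K(3) p by simp
  qed
  show ?thesis
    using sub[OF assms(2,3,4)] sub[OF assms(3,2) assms(4)[symmetric]] by blast
qed

section \<open>Coefficients and linear independence\<close>

lemma finite_sym_group: "finite (carrier (sym_group n))"
  by (simp add: sym_group_def finite_permutations)

lemma lookup_x_elt:
  "Poly_Mapping.lookup (x_elt n J) p = (if p permutes {1..n} \<and> descents n p \<subseteq> J then 1 else 0)"
proof -
  have "finite {q \<in> carrier (sym_group n). descents n q \<subseteq> J}"
    using finite_sym_group by simp
  then show ?thesis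
    by (simp add: x_elt_def lookup_sum lookup_single when_def sym_group_carrier)
qed

lemma lookup_face_sum:
  "Poly_Mapping.lookup (face_sum n J) f =
     (if f \<in> faces n \<and> map card f = composition_of n J then 1 else 0)"
  using finite_faces[of n]
  by (simp add: face_sum_def lookup_sum lookup_single when_def)

text \<open>The system is triangular: at a permutation with descent set \<open>K\<close>, only the
  sets \<open>J\<close> containing \<open>K\<close> contribute. Coefficients are therefore compared
  from large sets downwards.\<close>

lemma x_elt_independent:
  assumes "n \<ge> 1"
    and eq: "(\<Sum>J\<in>Pow {1..<n}. scale (c J) (x_elt n J)) = (\<Sum>J\<in>Pow {1..<n}. scale (d J) (x_elt n J))"
    and "K \<subseteq> {1..<n}"
  shows "c K = d K"
  using assms(3)
proof (induction "n - card K" arbitrary: K rule: less_induct)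
  case less
  obtain p where p: "p permutes {1..n}" "descents n p = K"
    using ex_perm_descents_eq[OF assms(1) less.prems] .
  have "(\<Sum>J\<in>Pow {1..<n}. c J * Poly_Mapping.lookup (x_elt n J) p)
      = (\<Sum>J\<in>Pow {1..<n}. d J * Poly_Mapping.lookup (x_elt n J) p)"
    using arg_cong[OF eq, of "\<lambda>a. Poly_Mapping.lookup a p"] by (simp add: lookup_sum)
  moreover have "(\<Sum>J\<in>Pow {1..<n}. b J * Poly_Mapping.lookup (x_elt n J) p)
      = b K + (\<Sum>J\<in>{J. K \<subset> J \<and> J \<subseteq> {1..<n}}. b J)" for b :: "nat set \<Rightarrow> complex"
  proof -
    have "(\<Sum>J\<in>Pow {1..<n}. b J * Poly_Mapping.lookup (x_elt n J) p)
        = (\<Sum>J\<in>{J. K \<subseteq> J \<and> J \<subseteq> {1..<n}}. b J)"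
      using p by (intro sum.mono_neutral_cong_right) (auto simp: lookup_x_elt)
    also have "{J. K \<subseteq> J \<and> J \<subseteq> {1..<n}} = insert K {J. K \<subset> J \<and> J \<subseteq> {1..<n}}"
      using less.prems by auto
    also have "(\<Sum>J\<in>\<dots>. b J) = b K + (\<Sum>J\<in>{J. K \<subset> J \<and> J \<subseteq> {1..<n}}. b J)"
      by (intro sum.insert) (auto intro: finite_subset[of _ "Pow {1..<n}"])
    finally show ?thesis .
  qed
  moreover have "c J = d J" if "K \<subset> J" "J \<subseteq> {1..<n}" for J
  proof (rule less.hyps)
    have "finite J" using that(2) finite_subset by blast
    then show "n - card J < n - card K"
      using psubset_card_mono[OF _ that(1)] card_mono[OF _ that(2)] assms(1) by simp
  qed fact
  ultimately show ?case by simp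
qed

text \<open>Independence of the \<open>x_elt n J\<close> makes the coefficients in the description
  of \<open>bidigare\<close> unique.\<close>

lemma bidigare_sum:
  assumes "n \<ge> 1"
  shows "bidigare n (\<Sum>J\<in>Pow {1..<n}. scale (c J) (x_elt n J))
    = (\<Sum>J\<in>Pow {1..<n}. scale (c J) (face_sum n J))"
  unfolding bidigare_def
proof (rule the_equality)
  fix y assume "\<exists>d. (\<Sum>J\<in>Pow {1..<n}. scale (c J) (x_elt n J)) = (\<Sum>J\<in>Pow {1..<n}. scale (d J) (x_elt n J)) \<and>
      y = (\<Sum>J\<in>Pow {1..<n}. scale (d J) (face_sum n J))"
  then obtain d where d: "(\<Sum>J\<in>Pow {1..<n}. scale (c J) (x_elt n J)) = (\<Sum>J\<in>Pow {1..<n}. scale (d J) (x_elt n J))"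
    "y = (\<Sum>J\<in>Pow {1..<n}. scale (d J) (face_sum n J))" by blast
  show "y = (\<Sum>J\<in>Pow {1..<n}. scale (c J) (face_sum n J))"
    unfolding d(2) using x_elt_independent[OF assms d(1)] by (intro sum.cong) auto
qed blast


section \<open>Bidigare's antiisomorphism\<close>

lemma bilinear_eqI:
  assumes "\<And>b. linear_fun scale (\<lambda>a. F a b)" "\<And>a. linear_fun scale (F a)"
    and "\<And>b. linear_fun scale (\<lambda>a. G a b)" "\<And>a. linear_fun scale (G a)"
    and "\<And>x y. x \<in> Poly_Mapping.keys a \<Longrightarrow> y \<in> Poly_Mapping.keys b \<Longrightarrow>
      F (basis_elt x) (basis_elt y) = G (basis_elt x) (basis_elt y)"
  shows "F a b = G a b"
  using linear_fun_eqI[OF assms(1,3)] linear_fun_eqI[OF assms(2,4)] assms(5) by metis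

lemma linear_fun_simps:
  assumes "linear_fun s f"
  shows "f (a + b) = f a + f b" "f (scale c a) = s c (f a)" "f (\<Sum>i\<in>I. g i) = (\<Sum>i\<in>I. f (g i))"
proof -
  interpret Vector_Spaces.linear scale s f by fact
  show "f (a + b) = f a + f b" "f (scale c a) = s c (f a)" "f (\<Sum>i\<in>I. g i) = (\<Sum>i\<in>I. f (g i))"
    by (simp_all add: add scale sum)
qed

lemma linear_fun_times:
  fixes f :: "('a \<Rightarrow>\<^sub>0 complex) \<Rightarrow> complex"
  assumes "linear_fun (*) f"
  shows "linear_fun (*) (\<lambda>a. c * f a)" "linear_fun (*) (\<lambda>a. f a * c)"
proof -
  interpret Vector_Spaces.linear scale "(*)" f by fact
  show "linear_fun (*) (\<lambda>a. c * f a)" 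
   by unfold_locales (simp_all only: add scale distrib_left mult.left_commute)
  show "linear_fun (*) (\<lambda>a. f a * c)"
   by unfold_locales (simp_all only: add scale distrib_right mult.assoc)
qed

lemma lookup_linext_inj:
  assumes "inj g"
  shows "Poly_Mapping.lookup (linext scale (\<lambda>x. basis_elt (g x)) a) (g x) = Poly_Mapping.lookup a x"
proof -
  have "Poly_Mapping.lookup (linext scale (\<lambda>x. basis_elt (g x)) a) (g x)
      = (\<Sum>y\<in>Poly_Mapping.keys a. if y = x then Poly_Mapping.lookup a y else 0)"
    unfolding linext_def lookup_sum using assms
    by (intro sum.cong) (auto simp: lookup_single when_def inj_def)
  then show ?thesis
    by (simp add: in_keys_iff)
qed

section \<open>The action of the symmetric group and its invariants\<close>

lemma perm_act_linext: "perm_act p = linext scale (\<lambda>f. basis_elt (map (image p) f))"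
  unfolding perm_act_def linext_def by (subst single_eq_scale) simp

lemma linear_perm_act: "linear_fun scale (perm_act p)"
  by (simp add: perm_act_linext)

lemma perm_act_basis_elt [simp]: "perm_act p (basis_elt f) = basis_elt (map (image p) f)"
  by (simp add: perm_act_linext fin_supp.vector_space_axioms)

lemma lookup_perm_act:
  assumes "p permutes {1..n}"
  shows "Poly_Mapping.lookup (perm_act p a) (map (image p) f) = Poly_Mapping.lookup a f"
proof -
  have "inj (map (image p))"
    using permutes_inj[OF assms] by (simp add: inj_image_eq_iff inj_def)
  then show ?thesis
    unfolding perm_act_linext by (rule lookup_linext_inj)
qed

lemma carrier_face_algebra: "carrier (face_algebra n) = {a. Poly_Mapping.keys a \<subseteq> faces n}"
  by (simp add: face_algebra_def monoid_algebra_def face_monoid_def)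

lemma one_face_algebra: "\<one>\<^bsub>face_algebra n\<^esub> = basis_elt [{1..n}]"
  by (simp add: face_algebra_def monoid_algebra_def face_monoid_def)

lemma mult_face_monoid [simp]: "f \<otimes>\<^bsub>face_monoid n\<^esub> g = face_mult f g"
  by (simp add: face_monoid_def)

lemma perm_act_mult:
  assumes "p permutes {1..n}"
  shows "perm_act p (a \<otimes>\<^bsub>face_algebra n\<^esub> b) = perm_act p a \<otimes>\<^bsub>face_algebra n\<^esub> perm_act p b"
  unfolding face_algebra_def
proof (rule bilinear_eqI[where a = a and b = b])
  fix x y
  show "perm_act p (basis_elt x \<otimes>\<^bsub>monoid_algebra (face_monoid n)\<^esub> basis_elt y) =
    perm_act p (basis_elt x) \<otimes>\<^bsub>monoid_algebra (face_monoid n)\<^esub> perm_act p (basis_elt y)"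
    by (simp add: face_mult_map_image permutes_inj[OF assms])
qed (intro linear_fun_comp[OF linear_mult_left linear_perm_act]
    linear_fun_comp[OF linear_mult_right linear_perm_act]
    linear_fun_comp[OF linear_perm_act linear_mult_left]
    linear_fun_comp[OF linear_perm_act linear_mult_right])+

lemma carrier_invariant_algebra:
  "carrier (invariant_algebra n) =
     {a. Poly_Mapping.keys a \<subseteq> faces n \<and> (\<forall>p. p permutes {1..n} \<longrightarrow> perm_act p a = a)}"
  by (auto simp: invariant_algebra_def carrier_face_algebra sym_group_carrier)

lemma mult_invariant_algebra [simp]: "a \<otimes>\<^bsub>invariant_algebra n\<^esub> b = a \<otimes>\<^bsub>face_algebra n\<^esub> b"
  and one_invariant_algebra [simp]: "\<one>\<^bsub>invariant_algebra n\<^esub> = \<one>\<^bsub>face_algebra n\<^esub>"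
  by (simp_all add: invariant_algebra_def)

lemma complex_algebra_face_algebra: "n \<ge> 1 \<Longrightarrow> complex_algebra (face_algebra n)"
  unfolding face_algebra_def by (intro complex_algebra_monoid_algebra face_monoid)

lemma complex_algebra_invariant_algebra:
  assumes "n \<ge> 1"
  shows "complex_algebra (invariant_algebra n)"
proof -
  interpret A: complex_algebra "face_algebra n"
    using assms by (rule complex_algebra_face_algebra)
  note lin = linear_fun_simps[OF linear_perm_act]
  let ?B = "carrier (invariant_algebra n)"
  have sub: "?B \<subseteq> carrier (face_algebra n)"
    by (auto simp: carrier_invariant_algebra carrier_face_algebra)
  have inv: "a \<in> ?B \<longleftrightarrow> a \<in> carrier (face_algebra n) \<and> (\<forall>p. p permutes {1..n} \<longrightarrow> perm_act p a = a)"
    for a by (auto simp: carrier_invariant_algebra carrier_face_algebra)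
  have "fin_supp.subspace ?B"
  proof (rule fin_supp.subspaceI)
    show "0 \<in> ?B"
      by (simp add: carrier_invariant_algebra perm_act_def)
  next
    fix x y assume "x \<in> ?B" "y \<in> ?B"
    then show "x + y \<in> ?B"
      unfolding inv using A.a_closed[of x y] by (simp add: lin)
  next
    fix c x assume "x \<in> ?B"
    then show "scale c x \<in> ?B"
      unfolding inv using fin_supp.subspace_scale[OF A.subspace_carrier, of x c] by (simp add: lin)
  qed
  moreover have "\<one>\<^bsub>face_algebra n\<^esub> \<in> ?B"
  proof -
    have "perm_act p \<one>\<^bsub>face_algebra n\<^esub> = \<one>\<^bsub>face_algebra n\<^esub>" if "p permutes {1..n}" for p
      using permutes_image[OF that] by (simp add: face_algebra_def monoid_algebra_def face_monoid_def)
    then show ?thesis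
      by (simp add: inv)
  qed
  moreover have "x \<otimes>\<^bsub>face_algebra n\<^esub> y \<in> ?B" if "x \<in> ?B" "y \<in> ?B" for x y
    using that by (simp add: inv perm_act_mult)
  ultimately have "complex_algebra (face_algebra n\<lparr>carrier := ?B\<rparr>)"
    using sub by (rule_tac A.complex_subalgebra)
  then show ?thesis
    by (simp add: invariant_algebra_def)
qed

lemma invariant_lookup_eq:
  assumes "a \<in> carrier (invariant_algebra n)" "f \<in> faces n" "g \<in> faces n" "map card f = map card g"
  shows "Poly_Mapping.lookup a f = Poly_Mapping.lookup a g"
proof -
  obtain p where p: "p permutes {1..n}" "g = map (image p) f"
    using ex_perm_same_type[OF assms(2-4)] .
  then have "perm_act p a = a"
    using assms(1) by (simp add: carrier_invariant_algebra)
  then show ?thesis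
    using lookup_perm_act[OF p(1), of a f] p(2) by simp
qed

lemma face_sum_invariant: "face_sum n J \<in> carrier (invariant_algebra n)"
proof -
  have "Poly_Mapping.keys (face_sum n J) \<subseteq> faces n"
    by (auto simp: in_keys_iff lookup_face_sum split: if_splits)
  moreover have "perm_act p (face_sum n J) = face_sum n J" if p: "p permutes {1..n}" for p
  proof -
    let ?F = "{f \<in> faces n. map card f = composition_of n J}"
    have cd: "map card (map (image q) f) = map card f" if "q permutes {1..n}" for q f
      using permutes_inj[OF that] by (simp add: card_image inj_on_subset comp_def)
    have "bij_betw (map (image p)) ?F ?F"
    proof (rule bij_betwI[of _ _ _ "map (image (inv' p))"])
      show "map (image p) \<in> ?F \<rightarrow> ?F" "map (image (inv' p)) \<in> ?F \<rightarrow> ?F"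
        using p permutes_inv[OF p] by (auto simp: map_image_in_faces cd simp del: map_map map_eq_conv)
    qed (simp_all add: image_image permutes_inverses[OF p] comp_def)
    then have "(\<Sum>f\<in>?F. basis_elt (map (image p) f)) = (\<Sum>f\<in>?F. basis_elt f)"
      by (rule sum.reindex_bij_betw)
    then show ?thesis
      by (simp add: face_sum_def linear_fun_simps[OF linear_perm_act])
  qed
  ultimately show ?thesis
    by (simp add: carrier_invariant_algebra)
qed

lemma invariant_eq_sum_face_sum:
  assumes "n \<ge> 1" "a \<in> carrier (invariant_algebra n)"
  obtains c where "a = (\<Sum>J\<in>Pow {1..<n}. scale (c J) (face_sum n J))"
proof
  \<comment> \<open>Invariance makes the coefficients constant on each type, so any face of the type
    may be chosen.\<close>
  define c where "c J = Poly_Mapping.lookup a (SOME f. f \<in> faces n \<and> map card f = composition_of n J)" for J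
  show "a = (\<Sum>J\<in>Pow {1..<n}. scale (c J) (face_sum n J))"
  proof (rule poly_mapping_eqI)
    fix f
    show "Poly_Mapping.lookup a f
        = Poly_Mapping.lookup (\<Sum>J\<in>Pow {1..<n}. scale (c J) (face_sum n J)) f"
    proof (cases "f \<in> faces n")
      case True
      then obtain K where K: "K \<subseteq> {1..<n}" "map card f = composition_of n K"
        using ex_face_type assms(1) by blast
      have "Poly_Mapping.lookup (\<Sum>J\<in>Pow {1..<n}. scale (c J) (face_sum n J)) f
          = (\<Sum>J\<in>Pow {1..<n}. if J = K then c J else 0)"
        unfolding lookup_sum
      proof (rule sum.cong)
        fix J assume "J \<in> Pow {1..<n}"
        then show "Poly_Mapping.lookup (scale (c J) (face_sum n J)) f = (if J = K then c J else 0)"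
          using composition_of_inject[OF assms(1), of J K] K True by (auto simp: lookup_face_sum)
      qed simp
      also have "\<dots> = c K"
        using K by simp
      also have "\<dots> = Poly_Mapping.lookup a f"
      proof -
        have "\<exists>f. f \<in> faces n \<and> map card f = composition_of n K"
          using True K by blast
        from someI_ex[OF this] show ?thesis
          unfolding c_def using K(2) True by (intro invariant_lookup_eq[OF assms(2)]) auto
      qed
      finally show ?thesis ..
    next
      case False
      then have "Poly_Mapping.lookup a f = 0"
        using assms(2) by (auto simp: carrier_invariant_algebra in_keys_iff)
      then show ?thesis
        using False by (simp add: lookup_sum lookup_face_sum)
    qed
  qed
qed

text \<open>Linear on the whole face algebra; it inverts Bidigare's map only when restricted to the
  invariants.\<close>

definition bidigare_inv :: "(nat set list \<Rightarrow>\<^sub>0 complex) \<Rightarrow> ((nat \<Rightarrow> nat) \<Rightarrow>\<^sub>0 complex)" where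
  "bidigare_inv = linext scale (\<lambda>f. basis_elt (face_perm f))"

lemma linear_bidigare_inv: "linear_fun scale bidigare_inv"
  by (simp add: bidigare_inv_def)

lemma bidigare_inv_basis_elt [simp]: "bidigare_inv (basis_elt f) = basis_elt (face_perm f)"
  by (simp add: bidigare_inv_def fin_supp.vector_space_axioms)

lemma bidigare_inv_face_sum:
  assumes "n \<ge> 1" "J \<subseteq> {1..<n}"
  shows "bidigare_inv (face_sum n J) = x_elt n J"
  using sum.reindex_bij_betw[OF bij_betw_face_perm[OF assms], of basis_elt]
  by (simp add: face_sum_def x_elt_def linear_fun_simps[OF linear_bidigare_inv] sym_group_carrier)

text \<open>
  As \<open>b\<close> is invariant, it may be replaced by its translate under \<open>face_perm g\<close> before it
  is multiplied by a face \<open>g\<close>.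
\<close>

lemma bidigare_inv_mult:
  assumes "a \<in> carrier (face_algebra n)" "b \<in> carrier (invariant_algebra n)"
  shows "bidigare_inv (b \<otimes>\<^bsub>face_algebra n\<^esub> a)
    = bidigare_inv a \<otimes>\<^bsub>monoid_algebra (sym_group n)\<^esub> bidigare_inv b"
proof (rule linear_fun_eqI[where a = a])
  fix g assume "g \<in> Poly_Mapping.keys a"
  then have g: "g \<in> faces n"
    using assms(1) by (auto simp: carrier_face_algebra)
  have "bidigare_inv (perm_act (face_perm g) b \<otimes>\<^bsub>face_algebra n\<^esub> basis_elt g)
      = basis_elt (face_perm g) \<otimes>\<^bsub>monoid_algebra (sym_group n)\<^esub> bidigare_inv b"
  proof (rule linear_fun_eqI[where a = b])
    fix f assume "f \<in> Poly_Mapping.keys b"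
    then have "f \<in> faces n"
      using assms(2) by (auto simp: carrier_invariant_algebra)
    then show "bidigare_inv (perm_act (face_perm g) (basis_elt f) \<otimes>\<^bsub>face_algebra n\<^esub> basis_elt g)
        = basis_elt (face_perm g) \<otimes>\<^bsub>monoid_algebra (sym_group n)\<^esub> bidigare_inv (basis_elt f)"
      using g by (simp add: face_algebra_def face_perm_face_mult sym_group_mult)
  next
    show "linear_fun scale (\<lambda>b. bidigare_inv (perm_act (face_perm g) b \<otimes>\<^bsub>face_algebra n\<^esub> basis_elt g))"
      unfolding face_algebra_def
      by (rule linear_fun_comp[OF linear_perm_act linear_fun_comp[OF linear_mult_left linear_bidigare_inv]])
  qed (rule linear_fun_comp[OF linear_bidigare_inv linear_mult_right])
  then show "bidigare_inv (b \<otimes>\<^bsub>face_algebra n\<^esub> basis_elt g)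
      = bidigare_inv (basis_elt g) \<otimes>\<^bsub>monoid_algebra (sym_group n)\<^esub> bidigare_inv b"
    using assms(2) face_perm_permutes[OF g] by (simp add: carrier_invariant_algebra)
next
  show "linear_fun scale (\<lambda>a. bidigare_inv (b \<otimes>\<^bsub>face_algebra n\<^esub> a))"
    unfolding face_algebra_def by (rule linear_fun_comp[OF linear_mult_right linear_bidigare_inv])
qed (rule linear_fun_comp[OF linear_bidigare_inv linear_mult_left])

lemma carrier_descent_algebra:
  "carrier (descent_algebra n) = fin_supp.span (x_elt n ` Pow {1..<n})"
  by (simp add: descent_algebra_def)

lemma bidigare_bidigare_inv:
  assumes "n \<ge> 1" "b \<in> carrier (invariant_algebra n)"
  shows "bidigare n (bidigare_inv b) = b" "bidigare_inv b \<in> carrier (descent_algebra n)"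
proof -
  obtain c where c: "b = (\<Sum>J\<in>Pow {1..<n}. scale (c J) (face_sum n J))"
    using invariant_eq_sum_face_sum[OF assms] .
  have "bidigare_inv b = (\<Sum>J\<in>Pow {1..<n}. scale (c J) (x_elt n J))"
    unfolding c linear_fun_simps[OF linear_bidigare_inv]
    using assms(1) by (intro sum.cong) (auto simp: bidigare_inv_face_sum)
  then show "bidigare n (bidigare_inv b) = b"
    using bidigare_sum[OF assms(1)] c by simp
  show "bidigare_inv b \<in> carrier (descent_algebra n)"
    unfolding \<open>bidigare_inv b = _\<close> carrier_descent_algebra
    by (intro fin_supp.span_sum fin_supp.span_scale fin_supp.span_base) auto
qed

text \<open>This transfers the multiplicative structure of the invariants to a space that is defined
  only as a span.\<close>

lemma descent_algebra_eq_image: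
  assumes "n \<ge> 1"
  shows "carrier (descent_algebra n) = bidigare_inv ` carrier (invariant_algebra n)"
proof
  interpret B: complex_algebra "invariant_algebra n"
    using assms by (rule complex_algebra_invariant_algebra)
  interpret L: Vector_Spaces.linear scale scale bidigare_inv
    by (rule linear_bidigare_inv)
  have "x_elt n ` Pow {1..<n} \<subseteq> bidigare_inv ` carrier (invariant_algebra n)"
    using bidigare_inv_face_sum[OF assms] face_sum_invariant by (auto simp: image_iff) metis
  then show "carrier (descent_algebra n) \<subseteq> bidigare_inv ` carrier (invariant_algebra n)"
    unfolding descent_algebra_def
    by (simp add: fin_supp.span_minimal L.subspace_image B.subspace_carrier)
qed (use bidigare_bidigare_inv[OF assms] in auto)

lemma bidigare_inv_bidigare:
  assumes "n \<ge> 1" "x \<in> carrier (descent_algebra n)"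
  shows "bidigare_inv (bidigare n x) = x" "bidigare n x \<in> carrier (invariant_algebra n)"
  using assms bidigare_bidigare_inv[OF assms(1)] descent_algebra_eq_image[OF assms(1)] by auto

lemma carrier_group_algebra:
  "carrier (monoid_algebra (sym_group n)) = {a. Poly_Mapping.keys a \<subseteq> {p. p permutes {1..n}}}"
  by (simp add: monoid_algebra_def sym_group_def)

lemma descent_algebra_subset: "carrier (descent_algebra n) \<subseteq> carrier (monoid_algebra (sym_group n))"
proof -
  have "x_elt n ` Pow {1..<n} \<subseteq> carrier (monoid_algebra (sym_group n))"
    by (auto simp: carrier_group_algebra in_keys_iff lookup_x_elt split: if_splits)
  then show ?thesis
    unfolding descent_algebra_def carrier_group_algebra
    by (simp add: fin_supp.span_minimal subspace_keys)
qed

text \<open>Closure under products is Solomon's theorem. It holds here because a product in the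
  group algebra is the image of the product of two invariants in the opposite order.\<close>

lemma complex_algebra_descent_algebra:
  assumes "n \<ge> 1"
  shows "complex_algebra (descent_algebra n)"
proof -
  interpret G: complex_algebra "monoid_algebra (sym_group n)"
    by (intro complex_algebra_monoid_algebra group.is_monoid sym_group_is_group)
  interpret B: complex_algebra "invariant_algebra n"
    using assms by (rule complex_algebra_invariant_algebra)
  let ?D = "carrier (descent_algebra n)"
  note im = descent_algebra_eq_image[OF assms]
  have "\<one>\<^bsub>monoid_algebra (sym_group n)\<^esub> = bidigare_inv \<one>\<^bsub>invariant_algebra n\<^esub>"
  proof -
    have "face_perm [{1..n}] = id"
    proof (rule face_perm_eqI)
      show "face_word [{1..n}] = map id [1..<Suc n]"
        using sorted_list_of_set_range[of 1 "Suc n"]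
        by (simp add: face_word_def atLeastLessThanSuc_atLeastAtMost del: upt_Suc)
    qed (use assms unit_face_in_faces permutes_id in auto)
    then show ?thesis
      by (simp only: one_invariant_algebra one_face_algebra bidigare_inv_basis_elt)
        (simp add: monoid_algebra_def sym_group_one)
  qed
  then have "\<one>\<^bsub>monoid_algebra (sym_group n)\<^esub> \<in> ?D"
    using im B.one_closed by blast
  moreover have "x \<otimes>\<^bsub>monoid_algebra (sym_group n)\<^esub> y \<in> ?D" if xy: "x \<in> ?D" "y \<in> ?D" for x y
  proof -
    obtain a b where ab: "x = bidigare_inv a" "y = bidigare_inv b"
      "a \<in> carrier (invariant_algebra n)" "b \<in> carrier (invariant_algebra n)"
      using xy im by auto
    then have "x \<otimes>\<^bsub>monoid_algebra (sym_group n)\<^esub> y = bidigare_inv (b \<otimes>\<^bsub>invariant_algebra n\<^esub> a)"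
      by (simp add: bidigare_inv_mult carrier_face_algebra carrier_invariant_algebra)
    then show ?thesis
      using im ab B.m_closed by blast
  qed
  moreover have "fin_supp.subspace ?D"
    by (simp add: descent_algebra_def)
  ultimately have "complex_algebra (monoid_algebra (sym_group n)\<lparr>carrier := ?D\<rparr>)"
    using descent_algebra_subset by (rule_tac G.complex_subalgebra)
  then show ?thesis
    by (simp add: descent_algebra_def)
qed

section \<open>The sign representation\<close>

definition sign_char :: "((nat \<Rightarrow> nat) \<Rightarrow>\<^sub>0 complex) \<Rightarrow> complex" where
  "sign_char = linext (*) (\<lambda>p. of_int (sign p))"

lemma linear_sign_char: "linear_fun (*) sign_char"
  by (simp add: sign_char_def)

lemma sign_char_basis_elt [simp]: "sign_char (basis_elt p) = of_int (sign p)"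
  by (simp add: sign_char_def complex_vs.vector_space_axioms)

lemma sign_compose_permutes:
  assumes "p permutes {1..n::nat}" "q permutes {1..n}"
  shows "sign (p \<circ> q) = sign p * sign q"
  using assms permutation_permutes by (intro sign_compose) blast+

lemma of_int_sign_mult_self [simp]: "of_int (sign p) * of_int (sign p) = (1 :: complex)"
  by (simp flip: of_int_mult)

lemma sign_char_mult:
  assumes "x \<in> carrier (monoid_algebra (sym_group n))" "y \<in> carrier (monoid_algebra (sym_group n))"
  shows "sign_char (x \<otimes>\<^bsub>monoid_algebra (sym_group n)\<^esub> y) = sign_char x * sign_char y"
proof (rule linear_fun_eqI[where a = x])
  fix p assume p: "p \<in> Poly_Mapping.keys x"
  show "sign_char (basis_elt p \<otimes>\<^bsub>monoid_algebra (sym_group n)\<^esub> y) = sign_char (basis_elt p) * sign_char y"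
  proof (rule linear_fun_eqI[where a = y])
    fix q assume "q \<in> Poly_Mapping.keys y"
    then have "p permutes {1..n}" "q permutes {1..n}"
      using p assms by (auto simp: carrier_group_algebra)
    then show "sign_char (basis_elt p \<otimes>\<^bsub>monoid_algebra (sym_group n)\<^esub> basis_elt q)
        = sign_char (basis_elt p) * sign_char (basis_elt q)"
      by (simp add: sym_group_mult sign_compose_permutes)
  next
    show "linear_fun (*) (\<lambda>y. sign_char (basis_elt p) * sign_char y)"
      by (rule linear_fun_times(1)[OF linear_sign_char])
  qed (rule linear_fun_comp[OF linear_mult_right linear_sign_char])
next
  show "linear_fun (*) (\<lambda>x. sign_char x * sign_char y)"
    by (rule linear_fun_times(2)[OF linear_sign_char])
qed (rule linear_fun_comp[OF linear_mult_left linear_sign_char])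

lemma algebra_character_sign_char:
  assumes "n \<ge> 1"
  shows "algebra_character (descent_algebra n) sign_char"
proof -
  interpret complex_algebra "descent_algebra n"
    using assms by (rule complex_algebra_descent_algebra)
  show ?thesis
  proof
    fix x y assume "x \<in> carrier (descent_algebra n)" "y \<in> carrier (descent_algebra n)"
    then show "sign_char (x \<otimes>\<^bsub>descent_algebra n\<^esub> y) = sign_char x * sign_char y"
      using sign_char_mult[of x n y] descent_algebra_subset[of n] by (auto simp: descent_algebra_def)
  next
    show "sign_char \<one>\<^bsub>descent_algebra n\<^esub> = 1"
      by (simp add: descent_algebra_def monoid_algebra_def sym_group_one)
  qed (simp_all add: linear_fun_simps[OF linear_sign_char])
qed

section \<open>The sign isotypic line\<close>

definition sign_vector :: "nat \<Rightarrow> (nat set list \<Rightarrow>\<^sub>0 complex)" where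
  "sign_vector n = (\<Sum>w | w permutes {1..n}. scale (of_int (sign w)) (basis_elt (chamber n w)))"

lemma lookup_sign_vector_chamber:
  assumes "w permutes {1..n}"
  shows "Poly_Mapping.lookup (sign_vector n) (chamber n w) = of_int (sign w)"
proof -
  have "Poly_Mapping.lookup (sign_vector n) (chamber n w)
      = (\<Sum>v | v permutes {1..n}. if v = w then of_int (sign v) else 0)"
    unfolding sign_vector_def lookup_sum using assms
    by (intro sum.cong) (auto simp: lookup_single when_def chamber_eq_iff)
  then show ?thesis
    using assms by (simp add: finite_permutations)
qed

lemma lookup_sign_vector_other:
  assumes "f \<notin> chamber n ` {w. w permutes {1..n}}"
  shows "Poly_Mapping.lookup (sign_vector n) f = 0"
  unfolding sign_vector_def lookup_sum using assms
  by (intro sum.neutral) (auto simp: lookup_single when_def)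

lemma perm_act_sign_vector:
  assumes p: "p permutes {1..n}"
  shows "perm_act p (sign_vector n) = scale (of_int (sign p)) (sign_vector n)"
proof -
  have "perm_act p (sign_vector n)
      = (\<Sum>w | w permutes {1..n}. scale (of_int (sign w)) (basis_elt (chamber n (p \<circ> w))))"
    by (simp add: sign_vector_def linear_fun_simps[OF linear_perm_act] map_image_chamber)
  also have "\<dots> = (\<Sum>w | w permutes {1..n}.
      scale (of_int (sign p * sign (p \<circ> w))) (basis_elt (chamber n (p \<circ> w))))"
    using p by (intro sum.cong) (auto simp: sign_compose_permutes)
  also have "\<dots> = (\<Sum>w | w permutes {1..n}. scale (of_int (sign p * sign w)) (basis_elt (chamber n w)))"
    by (rule setum_permutations_compose_left[OF p, symmetric])
  also have "\<dots> = scale (of_int (sign p)) (sign_vector n)"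
    by (simp add: sign_vector_def fin_supp.scale_sum_right)
  finally show ?thesis .
qed

text \<open>A face with a block of size at least two is fixed by a transposition.\<close>

lemma sign_isotypic_lookup_eq_0:
  assumes a: "a \<in> sign_isotypic n" and f: "f \<in> faces n" "f \<notin> chamber n ` {w. w permutes {1..n}}"
  shows "Poly_Mapping.lookup a f = 0"
proof -
  have "\<exists>P\<in>set f. \<nexists>i. P = {i}"
  proof (rule ccontr)
    assume "\<not> ?thesis"
    then have "map (\<lambda>i. {i}) (face_word f) = f"
      unfolding face_word_def by (induction f) auto
    then have "f = chamber n (face_perm f)"
      by (simp add: chamber_def comp_def map_face_perm[OF f(1), symmetric] del: upt_Suc)
    then show False
      using f face_perm_permutes by blast
  qed
  then obtain P x y where P: "P \<in> set f" "x \<in> P" "y \<in> P" "x \<noteq> y"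
    using f(1) by (auto simp: faces_iff) (metis insertI1 is_singletonI' is_singleton_def)
  let ?t = "transpose x y"
  have t: "?t permutes {1..n}"
    using P f(1) by (intro permutes_swap_id) (auto simp: faces_iff)
  have "?t ` Q = Q" if "Q \<in> set f" for Q
  proof (cases "Q = P")
    case False
    then have "P \<inter> Q = {}"
      using that P(1) f(1) by (auto simp: faces_def partition_on_def disjoint_def)
    then have "?t ` Q = id ` Q"
      using P by (intro image_cong) (auto simp: transpose_def)
    then show ?thesis by simp
  qed (use P in \<open>auto simp: transpose_image_eq\<close>)
  then have "map (image ?t) f = f"
    by (intro map_idI)
  moreover have "perm_act ?t a = scale (- 1) a"
    using a t P(4) by (auto simp: sign_isotypic_def sym_group_carrier sign_swap_id)
  ultimately have "Poly_Mapping.lookup a f = - Poly_Mapping.lookup a f"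
    using lookup_perm_act[OF t, of a f] by simp
  then show ?thesis
    by simp
qed

lemma sign_isotypic_eq: "sign_isotypic n = range (\<lambda>c. scale c (sign_vector n))"
proof (intro equalityI subsetI)
  fix a assume a: "a \<in> sign_isotypic n"
  \<comment> \<open>The chambers form one orbit, so this single coefficient determines the others up
    to sign.\<close>
  let ?c = "Poly_Mapping.lookup a (chamber n id)"
  have "a = scale ?c (sign_vector n)"
  proof (rule poly_mapping_eqI)
    fix f
    show "Poly_Mapping.lookup a f = Poly_Mapping.lookup (scale ?c (sign_vector n)) f"
    proof (cases "f \<in> chamber n ` {w. w permutes {1..n}}")
      case True
      then obtain w where w: "w permutes {1..n}" "f = chamber n w"
        by auto
      have "?c = Poly_Mapping.lookup (perm_act w a) (map (image w) (chamber n id))"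
        by (simp only: lookup_perm_act[OF w(1)])
      also have "map (image w) (chamber n id) = f"
        by (simp add: map_image_chamber w(2))
      also have "perm_act w a = scale (of_int (sign w)) a"
        using a w(1) by (simp add: sign_isotypic_def sym_group_carrier)
      finally have c: "?c = of_int (sign w) * Poly_Mapping.lookup a f"
        by (simp only: lookup_scale)
      have "?c * of_int (sign w) = Poly_Mapping.lookup a f"
        unfolding c by (simp add: mult.commute mult.left_commute)
      then show ?thesis
        by (simp only: w(2) lookup_scale lookup_sign_vector_chamber[OF w(1)])
    next
      case False
      then have "Poly_Mapping.lookup a f = 0"
        using sign_isotypic_lookup_eq_0[OF a] a
        by (cases "f \<in> faces n") (auto simp: sign_isotypic_def carrier_face_algebra in_keys_iff)
      then show ?thesis
        using False by (simp add: lookup_sign_vector_other)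
    qed
  qed
  then show "a \<in> range (\<lambda>c. scale c (sign_vector n))"
    by blast
next
  fix a assume "a \<in> range (\<lambda>c. scale c (sign_vector n))"
  then obtain c where c: "a = scale c (sign_vector n)" by blast
  have "Poly_Mapping.keys a \<subseteq> faces n"
  proof
    fix f assume "f \<in> Poly_Mapping.keys a"
    then have "Poly_Mapping.lookup (sign_vector n) f \<noteq> 0"
      by (auto simp: c in_keys_iff)
    then show "f \<in> faces n"
      using lookup_sign_vector_other[of f n] chamber_in_faces by blast
  qed
  then show "a \<in> sign_isotypic n"
    unfolding sign_isotypic_def carrier_face_algebra
    by (auto simp: c linear_fun_simps[OF linear_perm_act] perm_act_sign_vector sym_group_carrier
        mult.commute)
qed

lemma sign_vector_nonzero: "sign_vector n \<noteq> 0"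
  using lookup_sign_vector_chamber[OF permutes_id, of n] by auto

text \<open>By invariance, \<open>b\<close> may be translated by \<open>w\<close> before it meets
  \<open>chamber n w\<close>. Each face \<open>f\<close> then acts as right multiplication of
  \<open>w\<close> by \<open>face_perm f\<close>, and reindexing the alternating sum costs the sign
  of that permutation.\<close>

lemma invariant_mult_sign_vector:
  assumes b: "b \<in> carrier (invariant_algebra n)"
  shows "b \<otimes>\<^bsub>face_algebra n\<^esub> sign_vector n = scale (sign_char (bidigare_inv b)) (sign_vector n)"
proof -
  define L where "L w = linext scale (\<lambda>f. basis_elt (chamber n (w \<circ> face_perm f)))" for w
  have mult: "b \<otimes>\<^bsub>face_algebra n\<^esub> basis_elt (chamber n w) = L w b" if w: "w permutes {1..n}" for w
  proof -
    have "perm_act w b \<otimes>\<^bsub>face_algebra n\<^esub> basis_elt (chamber n w) = L w b"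
    proof (rule linear_fun_eqI[where a = b])
      fix f assume "f \<in> Poly_Mapping.keys b"
      then have f: "f \<in> faces n"
        using b by (auto simp: carrier_invariant_algebra)
      have "face_mult (map (image w) f) (map (image w) (chamber n id)) = chamber n (w \<circ> face_perm f)"
        unfolding face_mult_map_image[OF permutes_inj[OF w]] face_mult_chamber[OF f]
        by (rule map_image_chamber)
      then show "perm_act w (basis_elt f) \<otimes>\<^bsub>face_algebra n\<^esub> basis_elt (chamber n w) = L w (basis_elt f)"
        by (simp add: face_algebra_def L_def map_image_chamber fin_supp.vector_space_axioms)
    next
      show "linear_fun scale (\<lambda>b. perm_act w b \<otimes>\<^bsub>face_algebra n\<^esub> basis_elt (chamber n w))"
        unfolding face_algebra_def by (rule linear_fun_comp[OF linear_perm_act linear_mult_left])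
      show "linear_fun scale (L w)"
        by (simp add: L_def)
    qed
    then show ?thesis
      using b w by (simp add: carrier_invariant_algebra)
  qed
  have lin: "linear_fun scale (\<lambda>a. b \<otimes>\<^bsub>face_algebra n\<^esub> a)"
    unfolding face_algebra_def by simp
  have "b \<otimes>\<^bsub>face_algebra n\<^esub> sign_vector n = (\<Sum>w | w permutes {1..n}. scale (of_int (sign w)) (L w b))"
    unfolding sign_vector_def linear_fun_simps[OF lin] by (intro sum.cong) (auto simp: mult)
  also have "\<dots> = scale (sign_char (bidigare_inv b)) (sign_vector n)"
  proof (rule linear_fun_eqI[where a = b])
    fix f assume "f \<in> Poly_Mapping.keys b"
    then have f: "face_perm f permutes {1..n}"
      using b by (intro face_perm_permutes) (auto simp: carrier_invariant_algebra)
    let ?p = "face_perm f"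
    have "(\<Sum>w | w permutes {1..n}. scale (of_int (sign w)) (L w (basis_elt f)))
        = (\<Sum>w | w permutes {1..n}. scale (of_int (sign ?p * sign (w \<circ> ?p))) (basis_elt (chamber n (w \<circ> ?p))))"
      unfolding L_def using f
      by (intro sum.cong) (auto simp: sign_compose_permutes fin_supp.vector_space_axioms)
    also have "\<dots> = (\<Sum>w | w permutes {1..n}. scale (of_int (sign ?p * sign w)) (basis_elt (chamber n w)))"
      by (rule sum_permutations_compose_right[OF f, symmetric])
    also have "\<dots> = scale (of_int (sign ?p)) (sign_vector n)"
      by (simp add: sign_vector_def fin_supp.scale_sum_right)
    finally show "(\<Sum>w | w permutes {1..n}. scale (of_int (sign w)) (L w (basis_elt f)))
        = scale (sign_char (bidigare_inv (basis_elt f))) (sign_vector n)"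
      by simp
  next
    have "linear_fun scale (L w)" for w
      by (simp add: L_def)
    note lin = linear_fun_simps(1,2)[OF this]
    show "linear_fun scale (\<lambda>b. \<Sum>w | w permutes {1..n}. scale (of_int (sign w)) (L w b))"
      by unfold_locales (simp_all add: lin fin_supp.scale_right_distrib sum.distrib
          fin_supp.scale_sum_right mult.commute)
    show "linear_fun scale (\<lambda>b. scale (sign_char (bidigare_inv b)) (sign_vector n))"
      by unfold_locales (simp_all add: linear_fun_simps(1,2)[OF linear_sign_char]
          linear_fun_simps(1,2)[OF linear_bidigare_inv] fin_supp.scale_left_distrib)
  qed
  finally show ?thesis .
qed


section \<open>Signs of faces\<close>

text \<open>The parity of the number of inversions of a word, a form of the sign that can be
  evaluated block by block.\<close>

fun inversion_sign :: "'a::linorder list \<Rightarrow> int" where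
  "inversion_sign [] = 1"
| "inversion_sign (x # xs) = (- 1) ^ card {y \<in> set xs. y < x} * inversion_sign xs"

text \<open>Exactly one of the two orders counts the leading pair as an inversion; all other counts
  agree.\<close>

lemma inversion_sign_swap_hd:
  assumes "distinct (a # b # xs)"
  shows "inversion_sign (a # b # xs) = - inversion_sign (b # a # xs)"
proof -
  have card: "card {y \<in> set (b # xs). y < a} = card {y \<in> set xs. y < a} + (if b < a then 1 else 0)"
    if "b \<notin> set xs" for a b
  proof -
    have "{y \<in> set (b # xs). y < a} = (if b < a then insert b {y \<in> set xs. y < a} else {y \<in> set xs. y < a})"
      by auto
    then show ?thesis
      using that by simp
  qed
  show ?thesis
    unfolding inversion_sign.simps using assms by (subst (1 2) card) (auto simp: power_add)
qed

text \<open>An entry of the prefix sees only the set of the later entries, not their order.\<close>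

lemma inversion_sign_append_uminus:
  "set ys = set zs \<Longrightarrow> inversion_sign ys = - inversion_sign zs \<Longrightarrow>
    inversion_sign (xs @ ys) = - inversion_sign (xs @ zs)"
  by (induction xs) auto

text \<open>Moving \<open>a\<close> past \<open>ys\<close> takes \<open>length ys\<close> adjacent
  exchanges.\<close>

lemma inversion_sign_move:
  "distinct (a # ys @ zs) \<Longrightarrow>
    inversion_sign (a # ys @ zs) = (- 1) ^ length ys * inversion_sign (ys @ a # zs)"
proof (induction ys)
  case (Cons y ys)
  have "inversion_sign (a # (y # ys) @ zs) = - inversion_sign (y # a # ys @ zs)"
    using inversion_sign_swap_hd[of a y "ys @ zs"] Cons.prems by simp
  also have "inversion_sign (y # a # ys @ zs)
      = (- 1) ^ card {x \<in> set (ys @ a # zs). x < y} * inversion_sign (a # ys @ zs)"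
    by (simp only: inversion_sign.simps) simp
  also have "\<dots> = (- 1) ^ length ys * inversion_sign (y # ys @ a # zs)"
    using Cons by simp
  finally show ?case by simp
qed simp

text \<open>The moves of \<open>a\<close> and of \<open>b\<close> past \<open>ys\<close> contribute
  equal signs that cancel, leaving one adjacent exchange.\<close>

lemma inversion_sign_swap:
  assumes "distinct (a # ys @ b # zs)"
  shows "inversion_sign (xs @ a # ys @ b # zs) = - inversion_sign (xs @ b # ys @ a # zs)"
proof (rule inversion_sign_append_uminus)
  have "inversion_sign (a # ys @ b # zs) = (- 1) ^ length ys * inversion_sign (ys @ a # b # zs)"
    using assms by (intro inversion_sign_move) auto
  also have "inversion_sign (ys @ a # b # zs) = - inversion_sign (ys @ b # a # zs)"
    using assms by (intro inversion_sign_append_uminus inversion_sign_swap_hd) auto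
  also have "(- 1) ^ length ys * \<dots> = - inversion_sign (b # ys @ a # zs)"
    using inversion_sign_move[of b ys "a # zs"] assms by auto
  finally show "inversion_sign (a # ys @ b # zs) = - inversion_sign (b # ys @ a # zs)" .
qed auto

lemma inversion_sign_transpose:
  assumes "distinct xs" "a \<in> set xs" "b \<in> set xs" "a \<noteq> b"
  shows "inversion_sign (map (transpose a b) xs) = - inversion_sign xs"
proof -
  have *: "inversion_sign (map (transpose a b) (us @ a # vs @ b # ws)) = - inversion_sign (us @ a # vs @ b # ws)"
    if "distinct (us @ a # vs @ b # ws)" for a b :: 'a and us vs ws
  proof -
    have "map (transpose a b) us = us" "map (transpose a b) vs = vs" "map (transpose a b) ws = ws"
      using that by (auto intro!: map_idI simp: transpose_def)
    then have "map (transpose a b) (us @ a # vs @ b # ws) = us @ b # vs @ a # ws"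
      by simp
    then show ?thesis
      using inversion_sign_swap[of a vs b ws us] that by simp
  qed
  obtain us vs where uv: "xs = us @ a # vs"
    using assms(2) by (meson split_list)
  then consider "b \<in> set us" | "b \<in> set vs"
    using assms(3,4) by auto
  then show ?thesis
  proof cases
    case 1
    then obtain us1 us2 where "us = us1 @ b # us2"
      by (meson split_list)
    then show ?thesis
      using *[of us1 b us2 a vs] assms(1) uv by (simp add: transpose_commute)
  next
    case 2
    then obtain vs1 vs2 where "vs = vs1 @ b # vs2"
      by (meson split_list)
    then show ?thesis
      using *[of us a vs1 b vs2] assms(1) uv by simp
  qed
qed

text \<open>Building \<open>p\<close> from transpositions, each factor reverses both signs.\<close>

lemma inversion_sign_map_permutes:
  assumes "p permutes set xs" "distinct xs"
  shows "inversion_sign (map p xs) = sign p * inversion_sign xs"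
  using assms(1) finite_set
proof (induction rule: permutes_induct)
  case (swap a b p)
  have "inversion_sign (map (transpose a b) (map p xs)) = - inversion_sign (map p xs)"
    using swap assms(2) permutes_image[OF swap(4)] permutes_inj_on[OF swap(4)]
    by (intro inversion_sign_transpose) (auto simp: distinct_map)
  moreover have "sign (transpose a b \<circ> p) = - sign p"
    using swap permutation_permutes finite_set
    by (subst sign_compose) (auto simp: sign_swap_id permutation_swap_id)
  ultimately show ?case
    using swap.IH by (simp only: map_map)
qed simp

lemma inversion_sign_sorted: "sorted_wrt (<) xs \<Longrightarrow> inversion_sign xs = 1"
proof (induction xs)
  case (Cons x xs)
  then have "{y \<in> set xs. y < x} = {}"
    by auto
  with Cons show ?case
    by (simp del: Collect_empty_eq)
qed simp

lemma inversion_sign_append: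
  assumes "distinct (xs @ ys)" "\<And>x. x \<in> set xs \<Longrightarrow> even (card {y \<in> set ys. y < x})"
  shows "inversion_sign (xs @ ys) = inversion_sign xs * inversion_sign ys"
  using assms
proof (induction xs)
  case (Cons x xs)
  have "{y \<in> set (xs @ ys). y < x} = {y \<in> set xs. y < x} \<union> {y \<in> set ys. y < x}"
    by auto
  moreover have "card ({y \<in> set xs. y < x} \<union> {y \<in> set ys. y < x})
      = card {y \<in> set xs. y < x} + card {y \<in> set ys. y < x}"
    using Cons.prems(1) by (intro card_Un_disjoint) auto
  ultimately have "(- 1 :: int) ^ card {y \<in> set (xs @ ys). y < x} = (- 1) ^ card {y \<in> set xs. y < x}"
    using Cons.prems(2)[of x] by (simp add: power_add)
  with Cons show ?case
    by simp
qed simp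

lemma sign_face_perm:
  assumes "f \<in> faces n"
  shows "sign (face_perm f) = inversion_sign (face_word f)"
proof -
  have "set [1..<Suc n] = {1..n}"
    by auto
  then have "inversion_sign (map (face_perm f) [1..<Suc n]) = sign (face_perm f) * inversion_sign [1..<Suc n]"
    using face_perm_permutes[OF assms]
    by (intro inversion_sign_map_permutes) (simp_all del: upt_Suc)
  then show ?thesis
    unfolding map_face_perm[OF assms] by (simp add: inversion_sign_sorted del: upt_Suc)
qed

text \<open>
  The faces \<open>f\<close> with \<open>\<sigma>(f) \<ge> {{1,2},{3,4},\<dots>}\<close>; the last block of this partition
  is \<open>{n}\<close> if \<open>n\<close> is odd.
\<close>

definition paired :: "nat \<Rightarrow> nat set list \<Rightarrow> bool" where
  "paired n f \<longleftrightarrow> (\<forall>i. odd i \<longrightarrow> i < n \<longrightarrow> (\<exists>P\<in>set f. i \<in> P \<and> Suc i \<in> P))"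

text \<open>The elements below \<open>x\<close> fall into pairs of an odd \<open>y\<close> and
  \<open>Suc y\<close>. No pair is cut at \<open>x\<close>, since \<open>Suc y = x\<close> would put
  \<open>x\<close> into \<open>U\<close>; the even number 0, which would lack a partner, is
  excluded.\<close>

lemma even_card_below:
  fixes U :: "nat set"
  assumes "finite U" "0 \<notin> U" "x \<notin> U" "\<And>y. odd y \<Longrightarrow> y < x \<Longrightarrow> y \<in> U \<longleftrightarrow> Suc y \<in> U"
  shows "even (card {y \<in> U. y < x})"
proof -
  let ?O = "{y \<in> U. y < x \<and> odd y}" and ?E = "{y \<in> U. y < x \<and> even y}"
  have "bij_betw Suc ?O ?E"
  proof (rule bij_betwI[of _ _ _ "\<lambda>y. y - 1"])
    show "Suc \<in> ?O \<rightarrow> ?E"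
    proof
      fix y assume y: "y \<in> ?O"
      then have "Suc y \<in> U" using assms(4) by auto
      then have "Suc y \<noteq> x" using assms(3) by auto
      then show "Suc y \<in> ?E" using y \<open>Suc y \<in> U\<close> by auto
    qed
    show "(\<lambda>y. y - 1) \<in> ?E \<rightarrow> ?O"
    proof
      fix y assume y: "y \<in> ?E"
      then obtain z where "y = Suc z" using assms(2) by (cases y) auto
      then show "y - 1 \<in> ?O" using y assms(4)[of z] by auto
    qed
    show "Suc (y - 1) = y" if "y \<in> ?E" for y
      using that assms(2) by (cases y) auto
  qed simp
  then have "card ?O = card ?E"
    by (rule bij_betw_same_card)
  moreover have "{y \<in> U. y < x} = ?O \<union> ?E"
    by auto
  moreover have "card (?O \<union> ?E) = card ?O + card ?E"
    using assms(1) by (intro card_Un_disjoint) auto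
  ultimately show ?thesis
    by simp
qed

text \<open>Every block is a union of pairs, apart from a possible unpaired \<open>n\<close>, which
  lies below no entry. So each entry of a block exceeds an even number of entries in later blocks,
  and only inversions within the sorted blocks could remain.\<close>

lemma sign_face_perm_paired:
  assumes f: "f \<in> faces n" and p: "paired n f"
  shows "sign (face_perm f) = 1"
proof -
  \<comment> \<open>Stated block by block, the condition passes to the tail of a face in the
    induction, unlike \<open>paired n\<close>, which requires every pair to be present.\<close>
  have "i \<in> P \<longleftrightarrow> Suc i \<in> P" if i: "odd i" "i < n" and P: "P \<in> set f" for i P
  proof -
    obtain Q where Q: "Q \<in> set f" "i \<in> Q" "Suc i \<in> Q"
      using p i unfolding paired_def by blast
    show ?thesis
    proof (cases "P = Q")
      case False
      then have "P \<inter> Q = {}"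
        using f P Q(1) by (auto simp: faces_def partition_on_def disjoint_def)
      then show ?thesis using Q by blast
    qed (use Q in auto)
  qed
  moreover have "sorted_wrt disjnt f" "\<Union> (set f) \<subseteq> {1..n}" "distinct (face_word f)"
    using f faces_iff[of f n] faces_iff_word[of f n] by simp_all
  ultimately have "inversion_sign (face_word f) = 1"
  proof (induction f)
    case (Cons P f)
    have fin: "finite Q" if "Q \<in> set (P # f)" for Q
      using Cons.prems(3) that by (intro finite_subset[of Q "{1..n}"]) auto
    have set: "set (face_word f) = \<Union> (set f)"
      using fin by (auto simp: face_word_def)
    have word: "face_word (P # f) = sorted_list_of_set P @ face_word f"
      by (simp add: face_word_def)
    have "even (card {y \<in> set (face_word f). y < x})" if x: "x \<in> P" for x
    proof (rule even_card_below)
      show "0 \<notin> set (face_word f)"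
        using Cons.prems(3) by (auto simp: set)
      show "x \<notin> set (face_word f)"
        using Cons.prems(2) x by (auto simp: set disjnt_def)
      fix y assume y: "odd y" "y < x"
      moreover have "x \<le> n"
        using x Cons.prems(3) by auto
      ultimately show "y \<in> set (face_word f) \<longleftrightarrow> Suc y \<in> set (face_word f)"
        using Cons.prems(1)[of y] by (auto simp: set)
    qed simp
    then have "inversion_sign (face_word (P # f)) = inversion_sign (sorted_list_of_set P) * inversion_sign (face_word f)"
      unfolding word using Cons.prems(4) fin[of P]
      by (intro inversion_sign_append) (auto simp: word)
    moreover have "inversion_sign (face_word f) = 1"
      using Cons.prems by (intro Cons.IH) (auto simp: word)
    ultimately show ?case
      by (simp add: inversion_sign_sorted)
  qed (simp add: face_word_def)
  then show ?thesis
    using sign_face_perm[OF f] by simp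
qed

text \<open>Exchanging consecutive values can reverse the order only between these two, and no block
  contains both. The sorted list of each block is therefore mapped entry by entry.\<close>

lemma face_perm_transpose:
  assumes f: "f \<in> faces n" and i: "1 \<le> i" "i < n" and sep: "\<not> (\<exists>P\<in>set f. i \<in> P \<and> Suc i \<in> P)"
  defines "t \<equiv> transpose i (Suc i)"
  shows "face_perm (map (image t) f) = t \<circ> face_perm f"
proof (rule face_perm_eqI)
  have t: "t permutes {1..n}"
    unfolding t_def using i by (intro permutes_swap_id) auto
  show "map (image t) f \<in> faces n"
    by (rule map_image_in_faces[OF t f])
  show "t \<circ> face_perm f permutes {1..n}"
    by (intro permutes_compose face_perm_permutes f t)
  have "sorted_list_of_set (t ` P) = map t (sorted_list_of_set P)" if P: "P \<in> set f" for P
  proof -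
    have fin: "finite P"
      using finite_block[OF f P] .
    have mono: "t x < t y" if "x \<in> P" "y \<in> P" "x < y" for x y
      using that sep P unfolding t_def transpose_def by auto
    have "sorted_wrt (<) (map t (sorted_list_of_set P))"
      unfolding sorted_wrt_map
      by (rule sorted_wrt_mono_rel[OF _ strict_sorted_list_of_set[of P]]) (use fin mono in auto)
    then show ?thesis
      using sorted_list_of_set.idem_if_sorted_distinct[of "map t (sorted_list_of_set P)"] fin
      by (simp add: strict_sorted_iff)
  qed
  then have "face_word (map (image t) f) = map t (face_word f)"
    unfolding face_word_def map_concat map_map
    by (intro arg_cong[of _ _ concat] map_cong) auto
  then show "face_word (map (image t) f) = map (t \<circ> face_perm f) [1..<Suc n]"
    by (simp add: map_face_perm[OF f, symmetric] del: upt_Suc)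
qed

text \<open>
  The faces that are not paired cancel: exchange \<open>i\<close> and \<open>i + 1\<close> for the least
  odd \<open>i\<close> such that \<open>i\<close> and \<open>i + 1\<close> lie in different blocks.
\<close>

lemma sum_unpaired_eq_0:
  fixes a :: "nat set list \<Rightarrow> complex"
  assumes inv: "\<And>f p. f \<in> faces n \<Longrightarrow> p permutes {1..n} \<Longrightarrow> a (map (image p) f) = a f"
  shows "(\<Sum>f | f \<in> faces n \<and> \<not> paired n f. a f * of_int (sign (face_perm f))) = 0"
proof -
  define sep where "sep f i \<longleftrightarrow> odd i \<and> i < n \<and> \<not> (\<exists>P\<in>set f. i \<in> P \<and> Suc i \<in> P)" for f i
  define m where "m f = (LEAST i. sep f i)" for f
  define t where "t f = transpose (m f) (Suc (m f))" for f
  define \<phi> where "\<phi> f = map (image (t f)) f" for f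
  let ?U = "{f \<in> faces n. \<not> paired n f}"
  have paired: "paired n f \<longleftrightarrow> \<not> (\<exists>i. sep f i)" for f
    by (auto simp: paired_def sep_def)
  have least: "sep f (m f)" if "f \<in> ?U" for f
    using that paired unfolding m_def by (auto intro: LeastI)
  have sepD: "odd i" "1 \<le> i" "i < n" "\<not> (\<exists>P\<in>set f. i \<in> P \<and> Suc i \<in> P)" if "sep f i" for f i
    using that by (auto simp: sep_def Suc_le_eq odd_pos)
  \<comment> \<open>Pairs starting at odd numbers are equal or disjoint, so the exchange changes the
    separation of none of them. Hence the least separated pair stays the same and the exchange is an
    involution.\<close>
  have sep_transpose: "sep (map (image (transpose i (Suc i))) f) j \<longleftrightarrow> sep f j" if "odd i" for i j f
  proof -
    have "j \<in> transpose i (Suc i) ` P \<and> Suc j \<in> transpose i (Suc i) ` P \<longleftrightarrow> j \<in> P \<and> Suc j \<in> P"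
      if "odd j" for P
    proof -
      have mem: "x \<in> transpose i (Suc i) ` P \<longleftrightarrow> transpose i (Suc i) x \<in> P" for x
        by (metis image_iff transpose_involutory)
      have "j \<noteq> Suc i" "Suc j \<noteq> i"
        using that \<open>odd i\<close> by auto
      then show ?thesis
        unfolding mem by (cases "j = i") auto
    qed
    then have "(\<exists>P\<in>set (map (image (transpose i (Suc i))) f). j \<in> P \<and> Suc j \<in> P)
        \<longleftrightarrow> (\<exists>P\<in>set f. j \<in> P \<and> Suc j \<in> P)" if "odd j"
      using that by (simp only: set_map bex_simps(7) simp_thms)
    then show ?thesis
      unfolding sep_def by blast
  qed
  have perm: "t f permutes {1..n}" if "f \<in> ?U" for f
    using sepD[OF least[OF that]] unfolding t_def by (intro permutes_swap_id) auto
  have sep_\<phi>: "sep (\<phi> f) = sep f" if "f \<in> ?U" for f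
    unfolding \<phi>_def t_def by (intro ext sep_transpose sepD(1)[OF least[OF that]])
  have \<phi>: "\<phi> f \<in> ?U" if "f \<in> ?U" for f
    using that map_image_in_faces[OF perm[OF that], of f] sep_\<phi>[OF that]
    by (auto simp: paired) (simp_all add: \<phi>_def)
  have \<phi>\<phi>: "\<phi> (\<phi> f) = f" if "f \<in> ?U" for f
  proof -
    have "t (\<phi> f) = t f"
      by (simp add: t_def m_def sep_\<phi>[OF that])
    then have "\<phi> (\<phi> f) = map (image (t f \<circ> t f)) f"
      by (simp add: \<phi>_def[of "\<phi> f"]) (simp add: \<phi>_def image_image)
    then show ?thesis
      by (simp add: t_def)
  qed
  have bij: "bij_betw \<phi> ?U ?U"
    by (rule bij_betwI[of _ _ _ \<phi>]) (use \<phi> \<phi>\<phi> in auto)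
  have sign: "sign (face_perm (\<phi> f)) = - sign (face_perm f)" if "f \<in> ?U" for f
  proof -
    have f: "f \<in> faces n" using that by simp
    have "face_perm (\<phi> f) = t f \<circ> face_perm f"
      unfolding \<phi>_def t_def by (intro face_perm_transpose[OF f] sepD[OF least[OF that]])
    moreover have "sign (t f) = - 1"
      by (simp add: t_def sign_swap_id)
    ultimately show ?thesis
      using perm[OF that] face_perm_permutes[OF f] by (simp add: sign_compose_permutes)
  qed
  let ?S = "\<Sum>f\<in>?U. a f * of_int (sign (face_perm f))"
  have "?S = (\<Sum>f\<in>?U. a (\<phi> f) * of_int (sign (face_perm (\<phi> f))))"
    by (rule sum.reindex_bij_betw[OF bij, symmetric])
  also have "\<dots> = (\<Sum>f\<in>?U. - (a f * of_int (sign (face_perm f))))"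
    using inv[OF _ perm] by (intro sum.cong) (simp_all add: sign \<phi>_def[symmetric], auto simp: \<phi>_def)
  also have "\<dots> = - ?S"
    by (rule sum_negf)
  finally show ?thesis
    by simp
qed

lemma sign_char_bidigare_inv:
  assumes b: "b \<in> carrier (invariant_algebra n)"
  shows "sign_char (bidigare_inv b) = (\<Sum>f | f \<in> faces n \<and> paired n f. Poly_Mapping.lookup b f)"
proof -
  have "sign_char (bidigare_inv b) = linext (*) (\<lambda>f. of_int (sign (face_perm f))) b"
    by (rule linear_fun_eqI[OF linear_fun_comp[OF linear_bidigare_inv linear_sign_char]])
      (auto simp: complex_vs.vector_space_axioms)
  also have "\<dots> = (\<Sum>f\<in>faces n. Poly_Mapping.lookup b f * of_int (sign (face_perm f)))"
    using b by (intro linext_superset finite_faces complex_vs.vector_space_axioms)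
      (simp add: carrier_invariant_algebra)
  also have "faces n = {f. f \<in> faces n \<and> paired n f} \<union> {f. f \<in> faces n \<and> \<not> paired n f}"
    by auto
  also have "(\<Sum>f\<in>\<dots>. Poly_Mapping.lookup b f * of_int (sign (face_perm f)))
      = (\<Sum>f | f \<in> faces n \<and> paired n f. Poly_Mapping.lookup b f * of_int (sign (face_perm f))) + 
        (\<Sum>f | f \<in> faces n \<and> \<not> paired n f. Poly_Mapping.lookup b f * of_int (sign (face_perm f)))"
    using finite_faces[of n] by (intro sum.union_disjoint) auto
  also have "(\<Sum>f | f \<in> faces n \<and> \<not> paired n f. Poly_Mapping.lookup b f * of_int (sign (face_perm f))) = 0"
  proof (rule sum_unpaired_eq_0)
    fix f p assume "p permutes {1..n}"
    then show "Poly_Mapping.lookup b (map (image p) f) = Poly_Mapping.lookup b f"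
      using lookup_perm_act[of p n b f] b by (simp add: carrier_invariant_algebra)
  qed
  also have "(\<Sum>f | f \<in> faces n \<and> paired n f. Poly_Mapping.lookup b f * of_int (sign (face_perm f)))
      = (\<Sum>f | f \<in> faces n \<and> paired n f. Poly_Mapping.lookup b f)"
    by (intro sum.cong) (auto simp: sign_face_perm_paired)
  finally show ?thesis
    by simp
qed


section \<open>The pair partition\<close>

text \<open>The intersection has an effect only for \<open>i = n\<close>, where it cuts the last
  block down to the single point \<open>n\<close>.\<close>

definition pair_partition :: "nat \<Rightarrow> nat set set" where
  "pair_partition n = (\<lambda>i. {i, Suc i} \<inter> {1..n}) ` {i \<in> {1..n}. odd i}"

lemma pair_partition_partition: "partition_on {1..n} (pair_partition n)"
  unfolding pair_partition_def
proof (rule partition_onI)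
  have "\<exists>i\<in>{i \<in> {1..n}. odd i}. x \<in> {i, Suc i}" if "x \<in> {1..n}" for x
  proof (cases "odd x")
    case False
    with that obtain z where "x = Suc z" "odd z" by (cases x) auto
    then show ?thesis
      using that by (intro bexI[of _ z]) (auto simp: Suc_le_eq odd_pos)
  qed (use that in auto)
  then show "(\<Union>i\<in>{i \<in> {1..n}. odd i}. {i, Suc i} \<inter> {1..n}) = {1..n}"
    by blast
  show "{} \<notin> (\<lambda>i. {i, Suc i} \<inter> {1..n}) ` {i \<in> {1..n}. odd i}"
    by blast
  fix P Q
  assume "P \<in> (\<lambda>i. {i, Suc i} \<inter> {1..n}) ` {i \<in> {1..n}. odd i}"
    and "Q \<in> (\<lambda>i. {i, Suc i} \<inter> {1..n}) ` {i \<in> {1..n}. odd i}" and "P \<noteq> Q"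
  then obtain i j where "odd i" "odd j" "i \<noteq> j"
    and P: "P = {i, Suc i} \<inter> {1..n}" and Q: "Q = {j, Suc j} \<inter> {1..n}"
    by blast
  then have "{i, Suc i} \<inter> {j, Suc j} = {}"
    by auto
  then show "disjnt P Q"
    unfolding P Q disjnt_def by blast
qed

lemma block_type_pair_partition:
  "block_type (pair_partition n) = (if even n then replicate_mset (n div 2) 2
     else add_mset 1 (replicate_mset ((n - 1) div 2) 2))"
proof -
  let ?g = "\<lambda>i. {i, Suc i} \<inter> {1..n}"
  let ?O = "{i \<in> {1..n}. odd i}"
  have "inj_on ?g ?O"
  proof (rule inj_onI)
    fix i j assume ij: "i \<in> ?O" "j \<in> ?O" and eq: "?g i = ?g j"
    then have "i \<in> ?g j" "j \<in> ?g i" by auto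
    then show "i = j" using ij by auto
  qed
  then have image: "mset_set (?g ` ?O) = image_mset ?g (mset_set ?O)"
    by (rule image_mset_mset_set[symmetric])
  have type: "block_type (pair_partition n) = image_mset (\<lambda>i. card (?g i)) (mset_set ?O)"
    unfolding block_type_def pair_partition_def image by (simp only: multiset.map_comp comp_def)
  have card_odd: "card {i \<in> {1..2 * m}. odd i} = m" for m :: nat
  proof -
    have "{i \<in> {1..2 * m}. odd i} = (\<lambda>k. 2 * k + 1) ` {..<m}"
      by (auto elim!: oddE)
    then show ?thesis
      by (simp add: card_image inj_on_def)
  qed
  show ?thesis
  proof (cases "even n")
    case True
    then obtain m where m: "n = 2 * m" by blast
    have "card (?g i) = 2" if "i \<in> ?O" for i
    proof -
      have "i \<noteq> n" using that True by auto
      then have "?g i = {i, Suc i}" using that by auto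
      then show ?thesis by simp
    qed
    then have "image_mset (\<lambda>i. card (?g i)) (mset_set ?O) = image_mset (\<lambda>i. 2) (mset_set ?O)"
      by (intro image_mset_cong) simp
    then show ?thesis
      using True card_odd[of m] unfolding type by (simp add: image_mset_const_eq m)
  next
    case False
    then obtain m where m: "n = 2 * m + 1" by (auto elim: oddE)
    have O: "?O = insert n {i \<in> {1..2 * m}. odd i}"
      using m by auto
    have "card (?g i) = 2" if "i \<in> {i \<in> {1..2 * m}. odd i}" for i
    proof -
      have "?g i = {i, Suc i}" using that m by auto
      then show ?thesis by simp
    qed
    then have "image_mset (\<lambda>i. card (?g i)) (mset_set {i \<in> {1..2 * m}. odd i})
        = image_mset (\<lambda>i. 2) (mset_set {i \<in> {1..2 * m}. odd i})"
      by (intro image_mset_cong) simp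
    moreover have "?g n = {n}" using m by auto
    ultimately show ?thesis
      using False card_odd[of m] unfolding type O by (simp add: image_mset_const_eq m)
  qed
qed

text \<open>The single-point block that occurs for odd \<open>n\<close> imposes no condition,
  because every face covers \<open>n\<close>.\<close>

lemma paired_iff_refines:
  assumes "f \<in> faces n"
  shows "paired n f \<longleftrightarrow> refines {1..n} (pair_partition n) (set f)"
proof -
  have part: "partition_on {1..n} (set f)"
    using assms by (simp add: faces_def)
  have "paired n f \<longleftrightarrow> (\<forall>i\<in>{i \<in> {1..n}. odd i}. \<exists>P\<in>set f. {i, Suc i} \<inter> {1..n} \<subseteq> P)"
  proof
    assume p: "paired n f"
    show "\<forall>i\<in>{i \<in> {1..n}. odd i}. \<exists>P\<in>set f. {i, Suc i} \<inter> {1..n} \<subseteq> P"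
    proof
      fix i assume i: "i \<in> {i \<in> {1..n}. odd i}"
      show "\<exists>P\<in>set f. {i, Suc i} \<inter> {1..n} \<subseteq> P"
      proof (cases "i < n")
        case True
        then show ?thesis
          using p i unfolding paired_def by blast
      next
        case False
        then have "{i, Suc i} \<inter> {1..n} = {n}" and "n \<in> {1..n}"
          using i by auto
        moreover from this(2) obtain P where "P \<in> set f" "n \<in> P"
          using part unfolding partition_on_def by blast
        ultimately show ?thesis by auto
      qed
    qed
  next
    assume r: "\<forall>i\<in>{i \<in> {1..n}. odd i}. \<exists>P\<in>set f. {i, Suc i} \<inter> {1..n} \<subseteq> P"
    show "paired n f"
      unfolding paired_def
    proof (intro allI impI)
      fix i :: nat assume i: "odd i" "i < n"
      then have "i \<in> {i \<in> {1..n}. odd i}" "{i, Suc i} \<inter> {1..n} = {i, Suc i}"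
        by (auto simp: Suc_le_eq odd_pos)
      then show "\<exists>P\<in>set f. i \<in> P \<and> Suc i \<in> P"
        using r by (metis insert_subset)
    qed
  qed
  then show ?thesis
    using pair_partition_partition[of n] part unfolding refines_def pair_partition_def by simp
qed

text \<open>Sending each block of \<open>X\<close> to the block of \<open>Y\<close> around it is
  surjective. With equally many blocks it is injective too, so no block of \<open>Y\<close> is
  properly subdivided.\<close>

lemma refines_eq_if_card_eq:
  assumes ref: "refines A X Y" and "finite A" "card X = card Y"
  shows "X = Y"
proof -
  have X: "partition_on A X" and Y: "partition_on A Y" and sub: "\<forall>x\<in>X. \<exists>y\<in>Y. x \<subseteq> y"
    using ref by (auto simp: refines_def)
  have fin: "finite X"
    using X assms(2) by (rule_tac finite_elements)
  obtain g where g: "g x \<in> Y" "x \<subseteq> g x" if "x \<in> X" for x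
    using sub by metis
  have dX: "x = x'" if "x \<in> X" "x' \<in> X" "a \<in> x" "a \<in> x'" for x x' a
    using X that by (auto simp: partition_on_def disjoint_def)
  have dY: "y = y'" if "y \<in> Y" "y' \<in> Y" "a \<in> y" "a \<in> y'" for y y' a
    using Y that by (auto simp: partition_on_def disjoint_def)
  have mem: "\<exists>x\<in>X. a \<in> x \<and> g x = y" if "y \<in> Y" "a \<in> y" for y a
  proof -
    have "a \<in> A" using Y that by (auto simp: partition_on_def)
    then obtain x where "x \<in> X" "a \<in> x"
      using X by (auto simp: partition_on_def)
    then show ?thesis
      using g[of x] dY[of "g x" y a] that by blast
  qed
  have "Y \<subseteq> g ` X"
  proof
    fix y assume y: "y \<in> Y"
    then have "y \<noteq> {}"
      using Y by (auto simp: partition_on_def)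
    then show "y \<in> g ` X"
      using mem[OF y] by blast
  qed
  then have "g ` X = Y"
    using g(1) by blast
  then have inj: "inj_on g X"
    using fin assms(3) by (intro eq_card_imp_inj_on) auto
  have "y \<subseteq> x" if xy: "x \<in> X" "y = g x" for x y
  proof
    fix a assume "a \<in> y"
    then obtain x' where x': "x' \<in> X" "a \<in> x'" "g x' = y"
      using mem[of y a] g(1)[OF xy(1)] xy(2) by blast
    then have "x' = x"
      using xy by (rule_tac inj_onD[OF inj]) simp_all
    then show "a \<in> x"
      using x'(2) by simp
  qed
  then have "refines A Y X"
    using X Y \<open>g ` X = Y\<close> unfolding refines_def by blast
  with ref show ?thesis
    by (rule refines_asym)
qed

section \<open>Coefficient sums of the equivariant idempotents\<close>

lemma card_eq_if_block_type_eq: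
  assumes "block_type X = block_type Y"
  shows "card X = card Y"
  using arg_cong[OF assms, of size] by (simp add: block_type_def)

context
  fixes n E_hat
  assumes n: "n \<ge> 1" and saliola: "saliola_family n E_hat"
begin

lemma keys_E_hat:
  assumes "X \<in> set_partitions n"
  shows "Poly_Mapping.keys (E_hat X) \<subseteq> {f \<in> faces n. refines {1..n} (set f) X}"
  using saliola assms unfolding saliola_family_def fin_supp_span_basis_elt by blast

text \<open>The support of a contributing face is refined by \<open>X\<close> and refines
  \<open>Y\<close>; equal block counts force all three to coincide. What remains is the
  normalisation of the coefficients on the faces with support \<open>X\<close>.\<close>

lemma sum_E_hat_above:
  assumes X: "X \<in> set_partitions n" and Y: "Y \<in> set_partitions n" and card: "card X = card Y"
  shows "(\<Sum>f | f \<in> faces n \<and> refines {1..n} X (set f). Poly_Mapping.lookup (E_hat Y) f)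
    = (if Y = X then 1 else 0)"
proof -
  have XY: "Y = X \<and> set f = X"
    if "f \<in> faces n" "refines {1..n} X (set f)" "Poly_Mapping.lookup (E_hat Y) f \<noteq> 0" for f
  proof -
    have "refines {1..n} (set f) Y"
      using keys_E_hat[OF Y] that by (auto simp: in_keys_iff)
    moreover from this have "X = Y"
      using that(2) card refines_trans by (intro refines_eq_if_card_eq[of "{1..n}"]) auto
    ultimately show ?thesis
      using refines_asym that(2) by blast
  qed
  show ?thesis
  proof (cases "Y = X")
    case True
    have "(\<Sum>f | f \<in> faces n \<and> refines {1..n} X (set f). Poly_Mapping.lookup (E_hat Y) f)
        = (\<Sum>f | f \<in> faces n \<and> set f = X. Poly_Mapping.lookup (E_hat Y) f)"
    proof (rule sum.mono_neutral_right)
      show "{f. f \<in> faces n \<and> set f = X} \<subseteq> {f. f \<in> faces n \<and> refines {1..n} X (set f)}"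
        using X by (auto simp: set_partitions_def intro: refines_refl)
    qed (use XY finite_faces[of n] in auto)
    also have "\<dots> = 1"
      using saliola X True unfolding saliola_family_def by blast
    finally show ?thesis
      using True by simp
  next
    case False
    then show ?thesis
      using XY by (auto intro!: sum.neutral)
  qed
qed

definition type_sum :: "nat multiset \<Rightarrow> (nat set list \<Rightarrow>\<^sub>0 complex)" where
  "type_sum l = (\<Sum>X | X \<in> set_partitions n \<and> block_type X = l. E_hat X)"

lemma finite_set_partitions: "finite (set_partitions n)"
proof (rule finite_subset)
  show "set_partitions n \<subseteq> Pow (Pow {1..n})"
    by (auto simp: set_partitions_def partition_on_def)
qed simp

text \<open>Permutations preserve block sizes, so by equivariance they only rearrange the
  summands.\<close>

lemma type_sum_invariant: "type_sum l \<in> carrier (invariant_algebra n)"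
proof -
  let ?S = "{X \<in> set_partitions n. block_type X = l}"
  interpret A: complex_algebra "face_algebra n"
    using n by (rule complex_algebra_face_algebra)
  have "type_sum l \<in> carrier (face_algebra n)"
    unfolding type_sum_def
    using keys_E_hat by (intro fin_supp.subspace_sum[OF A.subspace_carrier])
      (auto simp: carrier_face_algebra)
  moreover have "perm_act p (type_sum l) = type_sum l" if p: "p permutes {1..n}" for p
  proof -
    have mem: "image q ` X \<in> ?S" if q: "q permutes {1..n}" and X: "X \<in> ?S" for q X
    proof -
      have inj: "inj q"
        using q by (rule permutes_inj)
      have part: "partition_on {1..n} X"
        using X by (simp add: set_partitions_def)
      have "\<Union> (image q ` X) = q ` \<Union> X" by blast
      then have "\<Union> (image q ` X) = {1..n}"
        using part permutes_image[OF q] by (simp add: partition_on_def)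
      moreover have "disjnt (q ` P) (q ` Q) \<longleftrightarrow> disjnt P Q" for P Q
        by (simp add: disjnt_def flip: image_Int[OF inj])
      ultimately have "partition_on {1..n} (image q ` X)"
        using part unfolding partition_on_def pairwise_image
        by (auto simp: pairwise_def)
      moreover have "block_type (image q ` X) = block_type X"
      proof -
        have "inj_on (image q) X"
          using inj by (simp add: inj_on_def inj_image_eq_iff)
        then have "mset_set (image q ` X) = image_mset (image q) (mset_set X)"
          by (rule image_mset_mset_set[symmetric])
        then show ?thesis
          using inj by (simp add: block_type_def multiset.map_comp comp_def card_image inj_on_subset)
      qed
      ultimately show ?thesis
        using X by (simp add: set_partitions_def)
    qed
    have "bij_betw (image (image p)) ?S ?S"
      using mem[OF p] mem[OF permutes_inv[OF p]]
      by (intro bij_betwI[of _ _ _ "image (image (inv' p))"])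
        (auto simp: image_image permutes_inverses[OF p])
    then have "(\<Sum>X\<in>?S. E_hat (image p ` X)) = (\<Sum>X\<in>?S. E_hat X)"
      by (rule sum.reindex_bij_betw)
    moreover have "perm_act p (E_hat X) = E_hat (image p ` X)" if "X \<in> ?S" for X
      using saliola p that unfolding saliola_family_def by (simp add: sym_group_carrier)
    ultimately show ?thesis
      unfolding type_sum_def linear_fun_simps[OF linear_perm_act] by simp
  qed
  ultimately show ?thesis
    by (simp add: carrier_invariant_algebra carrier_face_algebra)
qed

lemma sign_char_type_sum:
  "sign_char (bidigare_inv (type_sum (block_type (pair_partition n)))) = 1"
proof -
  let ?X = "pair_partition n"
  let ?S = "{Y \<in> set_partitions n. block_type Y = block_type ?X}"
  have X: "?X \<in> set_partitions n"
    using pair_partition_partition by (simp add: set_partitions_def)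
  have "sign_char (bidigare_inv (type_sum (block_type ?X)))
      = (\<Sum>f | f \<in> faces n \<and> paired n f. Poly_Mapping.lookup (type_sum (block_type ?X)) f)"
    by (rule sign_char_bidigare_inv[OF type_sum_invariant])
  also have "{f. f \<in> faces n \<and> paired n f} = {f. f \<in> faces n \<and> refines {1..n} ?X (set f)}"
    using paired_iff_refines by blast
  also have "(\<Sum>f\<in>\<dots>. Poly_Mapping.lookup (type_sum (block_type ?X)) f)
      = (\<Sum>Y\<in>?S. \<Sum>f | f \<in> faces n \<and> refines {1..n} ?X (set f). Poly_Mapping.lookup (E_hat Y) f)"
    unfolding type_sum_def lookup_sum by (rule sum.swap)
  also have "\<dots> = (\<Sum>Y\<in>?S. if Y = ?X then 1 else 0)"
  proof (rule sum.cong[OF refl])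
    fix Y assume "Y \<in> ?S"
    then show "(\<Sum>f | f \<in> faces n \<and> refines {1..n} ?X (set f). Poly_Mapping.lookup (E_hat Y) f)
        = (if Y = ?X then 1 else 0)"
      by (intro sum_E_hat_above X card_eq_if_block_type_eq) simp_all
  qed
  also have "\<dots> = 1"
    using X finite_set_partitions by simp
  finally show ?thesis .
qed

end

text \<open>Primitivity is symmetric under reversing products, so an antiisomorphism transports it
  just as an isomorphism would.\<close>

lemma primitive_idempotent_bidigare_inv:
  assumes n: "n \<ge> 1" and e: "primitive_idempotent (invariant_algebra n) e"
  shows "primitive_idempotent (descent_algebra n) (bidigare_inv e)"
proof -
  interpret B: complex_algebra "invariant_algebra n"
    using n by (rule complex_algebra_invariant_algebra)
  interpret D: complex_algebra "descent_algebra n"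
    using n by (rule complex_algebra_descent_algebra)
  note lin = linear_fun_simps[OF linear_bidigare_inv]
  have mult: "bidigare_inv a \<otimes>\<^bsub>descent_algebra n\<^esub> bidigare_inv b = bidigare_inv (b \<otimes>\<^bsub>face_algebra n\<^esub> a)"
    if "a \<in> carrier (invariant_algebra n)" "b \<in> carrier (invariant_algebra n)" for a b
    using bidigare_inv_mult[of a n b] that
    by (simp add: descent_algebra_def carrier_face_algebra carrier_invariant_algebra)
  have inj: "bidigare_inv a = bidigare_inv b \<longleftrightarrow> a = b"
    if "a \<in> carrier (invariant_algebra n)" "b \<in> carrier (invariant_algebra n)" for a b
    using bidigare_bidigare_inv(1)[OF n] that by metis
  have zero: "bidigare_inv 0 = 0"
    using lin(2)[of 0 0] by simp
  have inj0: "bidigare_inv a = 0 \<longleftrightarrow> a = 0" if "a \<in> carrier (invariant_algebra n)" for a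
    using inj[OF that, of 0] B.zero_closed zero by simp
  have ec: "e \<in> carrier (invariant_algebra n)" and prim: "\<And>a b. a \<in> carrier (invariant_algebra n) \<Longrightarrow>
      b \<in> carrier (invariant_algebra n) \<Longrightarrow> a \<noteq> 0 \<Longrightarrow> b \<noteq> 0 \<Longrightarrow>
      a \<otimes>\<^bsub>face_algebra n\<^esub> a = a \<Longrightarrow> b \<otimes>\<^bsub>face_algebra n\<^esub> b = b \<Longrightarrow>
      a \<otimes>\<^bsub>face_algebra n\<^esub> b = 0 \<Longrightarrow> b \<otimes>\<^bsub>face_algebra n\<^esub> a = 0 \<Longrightarrow> e \<noteq> a + b"
    using e unfolding primitive_idempotent_def by auto
  have "\<not> (\<exists>x\<in>carrier (descent_algebra n). \<exists>y\<in>carrier (descent_algebra n).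
      x \<noteq> 0 \<and> y \<noteq> 0 \<and> x \<otimes>\<^bsub>descent_algebra n\<^esub> x = x \<and> y \<otimes>\<^bsub>descent_algebra n\<^esub> y = y \<and>
      x \<otimes>\<^bsub>descent_algebra n\<^esub> y = 0 \<and> y \<otimes>\<^bsub>descent_algebra n\<^esub> x = 0 \<and> bidigare_inv e = x + y)"
  proof (rule notI, elim bexE conjE)
    fix x y assume "x \<in> carrier (descent_algebra n)" "y \<in> carrier (descent_algebra n)"
    then obtain a b where ab: "a \<in> carrier (invariant_algebra n)" "b \<in> carrier (invariant_algebra n)"
      and xy: "x = bidigare_inv a" "y = bidigare_inv b"
      by (auto simp: descent_algebra_eq_image[OF n])
    have closed: "a + b \<in> carrier (invariant_algebra n)"
      "\<And>c d. c \<in> {a, b} \<Longrightarrow> d \<in> {a, b} \<Longrightarrow> c \<otimes>\<^bsub>face_algebra n\<^esub> d \<in> carrier (invariant_algebra n)"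
      using ab B.a_closed[of a b] B.m_closed by auto
    assume "x \<noteq> 0" "y \<noteq> 0" "x \<otimes>\<^bsub>descent_algebra n\<^esub> x = x" "y \<otimes>\<^bsub>descent_algebra n\<^esub> y = y"
      "x \<otimes>\<^bsub>descent_algebra n\<^esub> y = 0" "y \<otimes>\<^bsub>descent_algebra n\<^esub> x = 0" "bidigare_inv e = x + y"
    then show False
      using prim[OF ab] ab closed ec unfolding xy by (simp add: mult inj inj0 flip: lin(1))
  qed
  moreover have "e \<noteq> 0" "e \<otimes>\<^bsub>face_algebra n\<^esub> e = e"
    using e by (auto simp: primitive_idempotent_def)
  ultimately show ?thesis
    using bidigare_bidigare_inv(2)[OF n ec] ec unfolding primitive_idempotent_def
    by (simp add: mult inj0)
qed

theorem proposition4p6: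
  fixes n :: nat
    and E_hat :: "nat set set \<Rightarrow> (nat set list \<Rightarrow>\<^sub>0 complex)"
    and E :: "nat multiset \<Rightarrow> (nat set list \<Rightarrow>\<^sub>0 complex)"
    and u :: "nat set list \<Rightarrow>\<^sub>0 complex"
    and lam :: "nat multiset"
  assumes "n \<ge> 1"
    and "saliola_family n E_hat"
    and "cfpoi (invariant_algebra n) (int_partitions n) E"
    and "u \<in> Units (invariant_algebra n)"
    and "\<And>l. l \<in> int_partitions n \<Longrightarrow>
           E l = u \<otimes>\<^bsub>invariant_algebra n\<^esub>
                   (\<Sum>X | X \<in> set_partitions n \<and> block_type X = l. E_hat X)
                   \<otimes>\<^bsub>invariant_algebra n\<^esub> inv\<^bsub>invariant_algebra n\<^esub> u"
    and "lam = (if even n then replicate_mset (n div 2) 2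
                else add_mset 1 (replicate_mset ((n - 1) div 2) 2))"
  shows "right_mod_isomorphic (descent_algebra n)
           (sign_right_mod n) (simple_right_mod n (E lam))"
proof -
  let ?A = "face_algebra n" and ?B = "invariant_algebra n" and ?D = "descent_algebra n"
  let ?\<chi> = "\<lambda>b. sign_char (bidigare_inv b)"
  note n = assms(1)
  interpret B: complex_algebra ?B
    using n by (rule complex_algebra_invariant_algebra)
  interpret D: algebra_character ?D sign_char
    using n by (rule algebra_character_sign_char)
  have lam: "lam \<in> int_partitions n"
    using assms(6) by (auto simp: int_partitions_def sum_mset_replicate_mset)
  have type: "lam = block_type (pair_partition n)"
    by (simp add: block_type_pair_partition assms(6))
  have \<chi>_mult: "?\<chi> (b \<otimes>\<^bsub>?B\<^esub> a) = ?\<chi> b * ?\<chi> a" if "a \<in> carrier ?B" "b \<in> carrier ?B" for a b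
  proof -
    have "bidigare_inv (b \<otimes>\<^bsub>?B\<^esub> a) = bidigare_inv a \<otimes>\<^bsub>?D\<^esub> bidigare_inv b"
      using bidigare_inv_mult[of a n b] that
      by (simp add: descent_algebra_def carrier_face_algebra carrier_invariant_algebra)
    then show ?thesis
      using bidigare_bidigare_inv(2)[OF n] that by (simp add: mult.commute)
  qed
  have E: "primitive_idempotent ?B (E lam)"
    using assms(3) lam by (auto simp: cfpoi_def)
  then have Ec: "E lam \<in> carrier ?B"
    by (simp add: primitive_idempotent_def)
  define e where "e = bidigare_inv (E lam)"
  have char_e: "sign_char e = 1"
  proof -
    define v where "v = inv\<^bsub>?B\<^esub> u"
    define h where "h = type_sum n E_hat lam"
    have u: "u \<in> carrier ?B" "v \<in> carrier ?B" and h: "h \<in> carrier ?B"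
      using assms(4) type_sum_invariant[OF n assms(2)]
      by (auto simp: v_def h_def Units_def)
    have uv: "u \<otimes>\<^bsub>?B\<^esub> v = \<one>\<^bsub>?B\<^esub>"
      using assms(4) by (simp only: v_def B.Units_r_inv)
    have "?\<chi> (E lam) = ?\<chi> (u \<otimes>\<^bsub>?B\<^esub> h \<otimes>\<^bsub>?B\<^esub> v)"
      using assms(5)[OF lam] by (simp add: v_def h_def type_sum_def[OF n assms(2)])
    \<comment> \<open>The values of the character commute, so the two conjugating factors can be
      brought together.\<close>
    also have "\<dots> = ?\<chi> u * ?\<chi> h * ?\<chi> v"
      by (simp only: \<chi>_mult[OF u(2) B.m_closed[OF u(1) h]] \<chi>_mult[OF h u(1)])
    also have "\<dots> = ?\<chi> (u \<otimes>\<^bsub>?B\<^esub> v) * ?\<chi> h"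
      unfolding \<chi>_mult[OF u(2,1)] by (simp only: mult_ac)
    also have "?\<chi> h = 1"
      using sign_char_type_sum[OF n assms(2)] by (simp add: h_def type)
    also have "?\<chi> (u \<otimes>\<^bsub>?B\<^esub> v) = 1"
    proof -
      \<comment> \<open>Multiplicativity alone allows the value 0 at the unit; cancelling the
        nonzero value at \<open>h\<close> excludes it.\<close>
      have "?\<chi> h * ?\<chi> \<one>\<^bsub>?B\<^esub> = ?\<chi> h"
        using \<chi>_mult[OF B.one_closed h] B.r_one[OF h] by simp
      then show ?thesis
        using \<open>?\<chi> h = 1\<close> uv by simp
    qed
    finally show ?thesis
      by (simp add: e_def)
  qed
  have e: "primitive_idempotent ?D e"
    unfolding e_def using n E by (rule primitive_idempotent_bidigare_inv)
  \<comment> \<open>Injectivity identifies the inverse in the definition of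
    \<open>proj_right_mod\<close> with \<open>bidigare_inv\<close>, so the module is the right ideal
    generated by \<open>e\<close>.\<close>
  have "inj_on (bidigare n) (carrier ?D)"
    by (rule inj_on_inverseI[of _ bidigare_inv]) (simp add: bidigare_inv_bidigare[OF n])
  then have "the_inv_into (carrier ?D) (bidigare n) (E lam) = e"
    unfolding e_def using bidigare_bidigare_inv[OF n Ec] by (intro the_inv_into_f_eq)
  then have P: "proj_right_mod n (E lam)
      = regular_right_mod ?D \<lparr>carrier := {e \<otimes>\<^bsub>?D\<^esub> x | x. x \<in> carrier ?D}\<rparr>"
    by (simp add: proj_right_mod_def)
  show ?thesis
    unfolding simple_right_mod_def P
  proof (rule D.isomorphic_top[OF e char_e])
    show "finite (x_elt n ` Pow {1..<n})" "carrier ?D \<subseteq> fin_supp.span (x_elt n ` Pow {1..<n})"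
      by (simp_all add: carrier_descent_algebra)
    show "carrier (sign_right_mod n) = range (\<lambda>c. scale c (sign_vector n))"
      by (simp add: sign_right_mod_def sign_isotypic_eq)
    show "sign_vector n \<noteq> 0"
      by (rule sign_vector_nonzero)
    show "v \<oplus>\<^bsub>sign_right_mod n\<^esub> w = v + w" for v w
      by (simp add: sign_right_mod_def face_right_mod_def face_algebra_def monoid_algebra_def)
    fix v x assume v: "v \<in> carrier (sign_right_mod n)" and x: "x \<in> carrier ?D"
    obtain c where c: "v = scale c (sign_vector n)"
      using v by (auto simp: sign_right_mod_def sign_isotypic_eq)
    have lin: "linear_fun scale (\<lambda>a. bidigare n x \<otimes>\<^bsub>?A\<^esub> a)"
      unfolding face_algebra_def by simp
    have "bidigare n x \<otimes>\<^bsub>?A\<^esub> v = scale c (scale (sign_char x) (sign_vector n))"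
      unfolding c linear_fun_simps(2)[OF lin] invariant_mult_sign_vector[OF bidigare_inv_bidigare(2)[OF n x]]
      by (simp add: bidigare_inv_bidigare(1)[OF n x])
    then show "v \<triangleleft>\<^bsub>sign_right_mod n\<^esub> x = scale (sign_char x) v"
      by (simp add: sign_right_mod_def face_right_mod_def c mult.commute)
  qed
qed

end
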